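(* Let $n\ge1$ be an integer and $p>\frac n{n+2}$. Let $D\in\mathcal M_n$ and let $X,Y$ be real symmetric $n\times n$ matrices. For $q>0$ such that the entropy $S^{(q)}(f_p(D,0,\cdot))$ is well defined, let $$g_D^{(T,p,q)}(X,Y)=\left.\frac{\partial^2}{\partial s\,\partial t}S^{(q)}\big(f_p(D+tX+sY,0,\cdot)\big)\right|_{t=s=0}.$$ Then $$g_D^{(T,p,1)}(X,Y)=g_D^{(T,1,1)}(X,Y)=\frac12\operatorname{Tr}(D^{-1}XD^{-1}Y).$$ Moreover, for $q\neq1$, if either ($p>1$ and $q>0$) or ($p<1$ and $q>\frac{n(1-p)}2$), which are the cases $p\ne 1$ in which $S^{(q)}(f_p(D,0,\cdot))$ is well defined, then $$g_D^{(T,p,q)}(X,Y)=A'_{n,p,q}\,(\det D)^{\frac{q-1}2}\left(\operatorname{Tr}(D^{-1}XD^{-1}Y)-\frac{q-1}2\operatorname{Tr}(XD^{-1})\operatorname{Tr}(YD^{-1})\right),$$ where $$A'_{n,p,q}=\frac12\left(\frac{p-1}{\pi(2p-n(1-p))}\right)^{\frac{n(q-1)}2}\left(\frac{\Gamma\left(\frac p{p-1}+\frac n2\right)}{\Gamma\left(\frac p{p-1}\right)}\right)^q\frac{\Gamma\left(\frac q{p-1}+1\right)}{\Gamma\left(\frac q{p-1}+1+\frac n2\right)}\quad\text{if }p>1,\ q>0,$$ $$A'_{n,p,q}=\frac12\left(\frac{1-p}{\pi(2p-n(1-p))}\right)^{\frac{n(q-1)}2}\left(\frac{\Gamma\left(\frac1{1-p}\right)}{\Gamma\left(\frac1{1-p}-\frac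 n2\right)}\right)^q\frac{\Gamma\left(\frac q{1-p}-\frac n2\right)}{\Gamma\left(\frac q{1-p}\right)}\quad\text{if }p<1,\ q>\tfrac{n(1-p)}2.$$
   Context: $\mathcal M_n$ is the set of real symmetric strictly positive definite $n\times n$ matrices. For a density $f$ on $\mathbb R^n$ and $q\in\mathbb R^+\setminus\{1\}$, the Tsallis entropy is $S^{(q)}(f)=\frac1{1-q}\left(\int_{\mathbb R^n}f(x)^q\,dx-1\right)$. For $q=1$ it is the limit $q\to1$, i.e. the usual entropy $S^{(1)}(f)=-\int_{\mathbb R^n}f(x)\log f(x)\,dx$ with $0\log0=0$. For $D\in\mathcal M_n$, $u\in\mathbb R^n$ and $p>\frac n{n+2}$, $p\ne1$, the $p$-generalized Gaussian density is $$f_p(D,u,x)=A_{n,p}\sqrt{\det D}\left(1+\tfrac{1-p}{2p-n(1-p)}\langle x-u,D(x-u)\rangle\right)^{\frac1{p-1}}$$ for $x\in\mathrm{Dom}(p,D,u)$ and $0$ otherwise. Here $\mathrm{Dom}(p,D,u)=\mathbb R^n$ if $\frac n{n+2}<p<1$, and $\mathrm{Dom}(p,D,u)=\{x\in\mathbb R^n: 1+\frac{1-p}{2p-n(1-p)}\langle x-u,D(x-u)\rangle\ge0\}$ if $p>1$. The normalization constant is $A_{n,p}=\left(\frac{1-p}{2p-n(1-p)}\right)^{n/2}\frac{\Gamma(\frac1{1-p})}{\pi^{n/2}\Gamma(\frac1{1-p}-\frac n2)}$ if $\frac n{n+2}<p<1$, and $A_{n,p}=\left(\frac{p-1}{2p-n(1-p)}\right)^{n/2}\frac{\Gamma(\frac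 p{p-1}+\frac n2)}{\pi^{n/2}\Gamma(\frac p{p-1})}$ if $p>1$. For $p=1$, $f_1(D,u,x)=\frac{\sqrt{\det D}}{(2\pi)^{n/2}}\exp\left(-\frac12\langle x-u,D(x-u)\rangle\right)$. *)

theory Defs
  imports "HOL-Analysis.Analysis"
begin

definition symmetric_matrix :: "real^'n^'n \<Rightarrow> bool" where
  "symmetric_matrix A \<longleftrightarrow> transpose A = A"

definition pos_def_matrices :: "(real^'n^'n) set" where
  "pos_def_matrices = {D. symmetric_matrix D \<and> (\<forall>x. x \<noteq> 0 \<longrightarrow> 0 < x \<bullet> (D *v x))}"

text \<open>The case \<open>q = 1\<close> is the usual entropy; the convention \<open>0 log 0 = 0\<close> holds
  automatically, and so does \<open>0 powr q = 0\<close>.\<close>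

definition tsallis_entropy :: "real \<Rightarrow> (real^'n \<Rightarrow> real) \<Rightarrow> real" where
  "tsallis_entropy q f =
     (if q = 1 then - (\<integral>x. f x * ln (f x) \<partial>lborel)
      else 1 / (1 - q) * ((\<integral>x. f x powr q \<partial>lborel) - 1))"

text \<open>The Bochner integral of a non-integrable function is 0, so that the value of
  \<^const>\<open>tsallis_entropy\<close> is meaningful only under the following condition.\<close>

definition tsallis_entropy_defined :: "real \<Rightarrow> (real^'n \<Rightarrow> real) \<Rightarrow> bool" where
  "tsallis_entropy_defined q f \<longleftrightarrow>
     (if q = 1 then integrable lborel (\<lambda>x. f x * ln (f x))
      else integrable lborel (\<lambda>x. f x powr q))"

text \<open>The formulas below are meant for \<open>p > n / (n + 2)\<close>, i.e. \<open>2 * p - n * (1 - p) > 0\<close>;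
  \<^term>\<open>gen_gauss_const n p\<close> is only used for \<open>p \<noteq> 1\<close>.\<close>

definition gen_gauss_const :: "nat \<Rightarrow> real \<Rightarrow> real" where
  "gen_gauss_const n p =
     (if p < 1 then
        ((1 - p) / (2 * p - real n * (1 - p))) powr (real n / 2) *
        (Gamma (1 / (1 - p)) / (pi powr (real n / 2) * Gamma (1 / (1 - p) - real n / 2)))
      else
        ((p - 1) / (2 * p - real n * (1 - p))) powr (real n / 2) *
        (Gamma (p / (p - 1) + real n / 2) / (pi powr (real n / 2) * Gamma (p / (p - 1)))))"

definition gen_gauss_base :: "real \<Rightarrow> real^'n^'n \<Rightarrow> real^'n \<Rightarrow> real^'n \<Rightarrow> real" where
  "gen_gauss_base p D u x =
     1 + (1 - p) / (2 * p - real CARD('n) * (1 - p)) * ((x - u) \<bullet> (D *v (x - u)))"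

definition gen_gauss_dom :: "real \<Rightarrow> real^'n^'n \<Rightarrow> real^'n \<Rightarrow> (real^'n) set" where
  "gen_gauss_dom p D u = (if p < 1 then UNIV else {x. gen_gauss_base p D u x \<ge> 0})"

definition gen_gauss :: "real \<Rightarrow> real^'n^'n \<Rightarrow> real^'n \<Rightarrow> real^'n \<Rightarrow> real" where
  "gen_gauss p D u x =
     (if p = 1 then
        sqrt (det D) / (2 * pi) powr (real CARD('n) / 2) *
        exp (- (1 / 2) * ((x - u) \<bullet> (D *v (x - u))))
      else if x \<in> gen_gauss_dom p D u then
        gen_gauss_const CARD('n) p * sqrt (det D) * gen_gauss_base p D u x powr (1 / (p - 1))
      else 0)"

text \<open>Since \<^const>\<open>deriv\<close> is total, existence of the mixed partial derivative
  \<open>\<partial>\<^sup>2F/\<partial>s\<partial>t\<close> at \<open>t = s = 0\<close> is expressed by a separate predicate.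
  The functions below take \<open>s\<close> as first and \<open>t\<close> as second argument.\<close>

definition mixed_partial :: "(real \<Rightarrow> real \<Rightarrow> real) \<Rightarrow> real" where
  "mixed_partial F = deriv (\<lambda>s. deriv (\<lambda>t. F s t) 0) 0"

definition mixed_partial_exists :: "(real \<Rightarrow> real \<Rightarrow> real) \<Rightarrow> bool" where
  "mixed_partial_exists F \<longleftrightarrow>
     (\<forall>\<^sub>F s in nhds 0. (\<lambda>t. F s t) field_differentiable at 0) \<and>
     (\<lambda>s. deriv (\<lambda>t. F s t) 0) field_differentiable at 0"

definition entropy_surface ::
  "real \<Rightarrow> real \<Rightarrow> real^'n^'n \<Rightarrow> real^'n^'n \<Rightarrow> real^'n^'n \<Rightarrow> real \<Rightarrow> real \<Rightarrow> real" where
  "entropy_surface p q D X Y s t =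
     tsallis_entropy q (gen_gauss p (D + t *\<^sub>R X + s *\<^sub>R Y) 0)"

definition tsallis_metric ::
  "real \<Rightarrow> real \<Rightarrow> real^'n^'n \<Rightarrow> real^'n^'n \<Rightarrow> real^'n^'n \<Rightarrow> real" where
  "tsallis_metric p q D X Y = mixed_partial (entropy_surface p q D X Y)"

definition tsallis_metric_exists ::
  "real \<Rightarrow> real \<Rightarrow> real^'n^'n \<Rightarrow> real^'n^'n \<Rightarrow> real^'n^'n \<Rightarrow> bool" where
  "tsallis_metric_exists p q D X Y \<longleftrightarrow> mixed_partial_exists (entropy_surface p q D X Y)"

definition tsallis_metric_const :: "nat \<Rightarrow> real \<Rightarrow> real \<Rightarrow> real" where
  "tsallis_metric_const n p q =
     (if p > 1 then
        1 / 2 * ((p - 1) / (pi * (2 * p - real n * (1 - p)))) powr (real n * (q - 1) / 2) *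
        (Gamma (p / (p - 1) + real n / 2) / Gamma (p / (p - 1))) powr q *
        (Gamma (q / (p - 1) + 1) / Gamma (q / (p - 1) + 1 + real n / 2))
      else
        1 / 2 * ((1 - p) / (pi * (2 * p - real n * (1 - p)))) powr (real n * (q - 1) / 2) *
        (Gamma (1 / (1 - p)) / Gamma (1 / (1 - p) - real n / 2)) powr q *
        (Gamma (q / (1 - p) - real n / 2) / Gamma (q / (1 - p))))"

end

theory Submission
  imports Defs
begin

text \<open>
  Up to the factor \<open>sqrt (det D)\<close>, the density \<open>f = gen_gauss p D 0\<close> depends on \<open>x\<close> only through
  the quadratic form \<open>x \<bullet> (D *v x)\<close>. A linear substitution that turns this form into \<open>x \<bullet> x\<close>
  has Jacobian \<open>1 / sqrt (det D)\<close>, so the integral of \<open>f powr q\<close> equals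
  \<open>C * det D powr ((q - 1) / 2)\<close>, where \<open>C\<close> is a radial integral independent of \<open>D\<close>. Likewise the
  integral of \<open>f * ln f\<close> equals \<open>ln (det D) / 2\<close> plus a constant. Hence every entropy in question is
  a function \<open>h (det D)\<close> of the determinant, and in all cases
  \<open>h' \<delta> = - K * \<delta> powr (a - 1)\<close> with \<open>a = (q - 1) / 2\<close>; for \<open>q = 1\<close> the constant is
  \<open>K = 1 / 2\<close> for every \<open>p\<close>, which is why the metric then does not depend on \<open>p\<close>.

  The metric follows from \<open>h'\<close> by two applications of the Jacobi formula for the derivative of a
  determinant and one of the derivative of the inverse matrix (\<open>mixed_partial_of_det\<close>).
  The constant \<open>K\<close> comes from the radial integrals: for \<open>p > 1\<close>, slicing
  \<open>(1 - x \<bullet> x) powr s\<close> into indicators of balls gives a Beta integral; for \<open>p < 1\<close>, writing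
  \<open>(1 + x \<bullet> x) powr (- s)\<close> as a Gamma mixture of Gaussians gives a Gamma integral with
  parameter \<open>s - n / 2\<close>. The latter is an identity in \<open>[0, \<infinity>]\<close>, so it also shows that
  the entropy is undefined when \<open>s = q / (1 - p)\<close> is at most \<open>n / 2\<close>.
\<close>

section \<open>Linear changes of variables\<close>

lemma borel_measurable_matrix_vector_mult [measurable]:
  fixes A :: "real^'n^'n"
  shows "(\<lambda>x. A *v x) \<in> borel_measurable borel"
  by (intro borel_measurable_continuous_onI matrix_vector_mult_linear_continuous_on)

lemma nn_integral_lborel_translate:
  fixes f :: "'a::euclidean_space \<Rightarrow> ennreal"
  assumes [measurable]: "f \<in> borel_measurable borel"
  shows "(\<integral>\<^sup>+x. f (c + x) \<partial>lborel) = (\<integral>\<^sup>+x. f x \<partial>lborel)"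
proof -
  have "(\<integral>\<^sup>+x. f x \<partial>lborel) = (\<integral>\<^sup>+x. f x \<partial>distr lborel borel ((+) c))"
    by (simp add: lborel_distr_plus)
  also have "\<dots> = (\<integral>\<^sup>+x. f (c + x) \<partial>lborel)"
    by (rule nn_integral_distr) auto
  finally show ?thesis ..
qed

lemma nn_integral_lborel_reflect:
  fixes f :: "'a::euclidean_space \<Rightarrow> ennreal"
  assumes [measurable]: "f \<in> borel_measurable borel"
  shows "(\<integral>\<^sup>+x. f (c - x) \<partial>lborel) = (\<integral>\<^sup>+x. f x \<partial>lborel)"
proof -
  have eq: "lborel = distr lborel borel (\<lambda>x::'a. c + (-1) *\<^sub>R x)"
    using lborel_affine[of "-1" c] by (simp add: density_1)
  have "(\<integral>\<^sup>+x. f x \<partial>lborel) = (\<integral>\<^sup>+x. f x \<partial>distr lborel borel (\<lambda>x::'a. c + (-1) *\<^sub>R x))"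
    by (subst eq) simp
  also have "\<dots> = (\<integral>\<^sup>+x. f (c - x) \<partial>lborel)"
    by (subst nn_integral_distr) auto
  finally show ?thesis ..
qed

text \<open>Uniqueness of Haar measure, for the image of Lebesgue measure under
  \<open>A\<close>: both measures are translation invariant, so evaluating the integral of
  \<open>f (A *v x) * g (A *v x - y)\<close> in the two possible orders shows that they are
  proportional. The form given here avoids naming the factor.\<close>

lemma nn_integral_linear_exchange:
  fixes A B :: "real^'n^'n" and f g :: "real^'n \<Rightarrow> ennreal"
  assumes AB: "A ** B = mat 1"
    and [measurable]: "f \<in> borel_measurable borel" "g \<in> borel_measurable borel"
  shows "(\<integral>\<^sup>+x. f (A *v x) \<partial>lborel) * (\<integral>\<^sup>+x. g x \<partial>lborel) =
         (\<integral>\<^sup>+x. g (A *v x) \<partial>lborel) * (\<integral>\<^sup>+x. f x \<partial>lborel)"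
proof -
  have "(\<integral>\<^sup>+x. f (A *v x) \<partial>lborel) * (\<integral>\<^sup>+y. g y \<partial>lborel) =
        (\<integral>\<^sup>+x. \<integral>\<^sup>+y. f (A *v x) * g (A *v x - y) \<partial>lborel \<partial>lborel)"
    by (subst nn_integral_cmult, simp, subst nn_integral_lborel_reflect)
       (simp_all add: nn_integral_multc)
  also have "\<dots> = (\<integral>\<^sup>+y. \<integral>\<^sup>+x. f (A *v x) * g (A *v x - y) \<partial>lborel \<partial>lborel)"
    by (rule lborel_pair.Fubini') simp
  (* Translating x by B *v y moves the shift by y from g to f. *)
  also have "\<dots> = (\<integral>\<^sup>+y. \<integral>\<^sup>+x. f (A *v x + y) * g (A *v x) \<partial>lborel \<partial>lborel)"
  proof (rule nn_integral_cong)
    fix y :: "real^'n"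
    have "(\<integral>\<^sup>+x. f (A *v x) * g (A *v x - y) \<partial>lborel) =
          (\<integral>\<^sup>+x. f (A *v (B *v y + x)) * g (A *v (B *v y + x) - y) \<partial>lborel)"
      by (rule nn_integral_lborel_translate[symmetric]) simp
    also have "\<dots> = (\<integral>\<^sup>+x. f (A *v x + y) * g (A *v x) \<partial>lborel)"
      by (simp add: matrix_vector_right_distrib matrix_vector_mul_assoc AB add.commute)
    finally show "(\<integral>\<^sup>+x. f (A *v x) * g (A *v x - y) \<partial>lborel) =
      (\<integral>\<^sup>+x. f (A *v x + y) * g (A *v x) \<partial>lborel)" .
  qed
  also have "\<dots> = (\<integral>\<^sup>+x. \<integral>\<^sup>+y. f (A *v x + y) * g (A *v x) \<partial>lborel \<partial>lborel)"
    by (rule lborel_pair.Fubini') simp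
  also have "\<dots> = (\<integral>\<^sup>+x. g (A *v x) \<partial>lborel) * (\<integral>\<^sup>+x. f x \<partial>lborel)"
    by (subst nn_integral_multc, simp, subst nn_integral_lborel_translate)
       (simp_all add: nn_integral_cmult mult.commute)
  finally show ?thesis .
qed

lemma ennreal_square_eq_imp_eq:
  fixes a b :: ennreal
  assumes "a * a = b * b"
  shows "a = b"
proof (cases a; cases b)
  fix r t assume rt: "a = ennreal r" "0 \<le> r" "b = ennreal t" "0 \<le> t"
  then have "r\<^sup>2 = t\<^sup>2"
    using assms by (simp add: ennreal_mult[symmetric] power2_eq_square)
  then show ?thesis
    using rt by (simp add: power2_eq_iff_nonneg)
qed (use assms in \<open>simp_all add: ennreal_mult[symmetric]\<close>)

text \<open>An involution may scale volumes only by a factor whose square is 1. With \<open>f =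
  g \<circ> A\<close> in the exchange identity this becomes an equality of squares.\<close>

lemma nn_integral_involution:
  fixes A :: "real^'n^'n" and g :: "real^'n \<Rightarrow> ennreal"
  assumes A: "A ** A = mat 1" and [measurable]: "g \<in> borel_measurable borel"
  shows "(\<integral>\<^sup>+x. g (A *v x) \<partial>lborel) = (\<integral>\<^sup>+x. g x \<partial>lborel)"
proof -
  have "(\<integral>\<^sup>+x. g (A *v x) \<partial>lborel) * (\<integral>\<^sup>+x. g (A *v x) \<partial>lborel) =
        (\<integral>\<^sup>+x. g (A *v (A *v x)) \<partial>lborel) * (\<integral>\<^sup>+x. g x \<partial>lborel)"
    by (rule nn_integral_linear_exchange[OF A, of g "\<lambda>x. g (A *v x)"]) simp_all
  then show ?thesis
    by (rule ennreal_square_eq_imp_eq[OF trans]) (simp add: matrix_vector_mul_assoc A)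
qed

lemma nn_integral_diagonal:
  fixes A :: "real^'n^'n" and g :: "real^'n \<Rightarrow> ennreal"
  assumes diag: "\<And>i j. i \<noteq> j \<Longrightarrow> A$i$j = 0" and det: "det A \<noteq> 0"
    and [measurable]: "g \<in> borel_measurable borel"
  shows "ennreal \<bar>det A\<bar> * (\<integral>\<^sup>+x. g (A *v x) \<partial>lborel) = (\<integral>\<^sup>+x. g x \<partial>lborel)"
proof -
  define c where "c b = (\<Sum>i\<in>UNIV. A$i$i * b$i)" for b :: "real^'n"
  have c_axis: "c (axis i 1) = A$i$i" for i
    by (simp add: c_def axis_def if_distrib cong: if_cong)
  have det_eq: "det A = (\<Prod>i\<in>UNIV. A$i$i)"
    by (rule det_diagonal) (rule diag)
  have Basis_eq: "Basis = range (\<lambda>i. axis i 1 :: real^'n)"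
    by (auto simp: Basis_vec_def)
  have inj: "inj (\<lambda>i. axis i 1 :: real^'n)"
    by (auto simp: inj_def axis_eq_axis)
  have prod_c: "(\<Prod>b\<in>Basis. \<bar>c b\<bar>) = \<bar>det A\<bar>"
    unfolding det_eq Basis_eq by (simp add: prod.reindex[OF inj] c_axis abs_prod)
  have c_nz: "c b \<noteq> 0" if "b \<in> Basis" for b
    using that det unfolding Basis_eq det_eq by (auto simp: c_axis)
  have T: "0 + (\<Sum>b\<in>Basis. (c b * (x \<bullet> b)) *\<^sub>R b) = A *v x" for x
  proof -
    have "(A *v x) $ i = A$i$i * x$i" for i
    proof -
      have "(A *v x) $ i = (\<Sum>j\<in>UNIV. if j = i then A$i$i * x$i else 0)"
        unfolding matrix_vector_mult_def vec_lambda_beta by (rule sum.cong) (auto simp: diag)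
      also have "\<dots> = A$i$i * x$i" by simp
      finally show ?thesis .
    qed
    moreover have "(\<Sum>b\<in>Basis. (c b * (x \<bullet> b)) *\<^sub>R b) $ i = A$i$i * x$i" for i
    proof -
      have "(\<Sum>b\<in>Basis. (c b * (x \<bullet> b)) *\<^sub>R b) $ i = 
        (\<Sum>j\<in>UNIV. (A$j$j * x$j) * (axis j 1 :: real^'n) $ i)"
        unfolding Basis_eq by (simp add: sum.reindex[OF inj] c_axis inner_axis)
      also have "\<dots> = A$i$i * x$i"
        by (simp add: axis_def if_distrib cong: if_cong)
      finally show ?thesis .
    qed
    ultimately show ?thesis
      by (simp add: vec_eq_iff)
  qed
  have "(\<integral>\<^sup>+x. g x \<partial>lborel) = 
    (\<integral>\<^sup>+x. g x \<partial>density (distr lborel borel (\<lambda>x. A *v x)) (\<lambda>_. ennreal \<bar>det A\<bar>))"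
    using lborel_affine_euclidean[of c 0] c_nz unfolding T prod_c by simp
  also have "\<dots> = ennreal \<bar>det A\<bar> * (\<integral>\<^sup>+x. g (A *v x) \<partial>lborel)"
    by (simp add: nn_integral_density nn_integral_distr nn_integral_cmult)
  finally show ?thesis ..
qed

text \<open>Every matrix is a product of elementary ones. Diagonal matrices scale the axes, and
  the other nonsingular elementary matrices reduce to involutions, whose determinant is
  \<open>1\<close> in absolute value.\<close>

lemma nn_integral_linear_change:
  fixes A :: "real^'n^'n" and g :: "real^'n \<Rightarrow> ennreal"
  assumes "det A \<noteq> 0" and "g \<in> borel_measurable borel"
  shows "ennreal \<bar>det A\<bar> * (\<integral>\<^sup>+x. g (A *v x) \<partial>lborel) = (\<integral>\<^sup>+x. g x \<partial>lborel)"
proof -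
  define P where "P A \<longleftrightarrow> (det A \<noteq> 0 \<longrightarrow> (\<forall>g\<in>borel_measurable borel.
    ennreal \<bar>det A\<bar> * (\<integral>\<^sup>+x. g (A *v x) \<partial>lborel) = (\<integral>\<^sup>+x. g x \<partial>lborel)))"
    for A :: "real^'n^'n"
  have mult: "P (A ** B)" if "P A" "P B" for A B
    unfolding P_def
  proof (intro impI ballI)
    fix g :: "real^'n \<Rightarrow> ennreal" assume g [measurable]: "g \<in> borel_measurable borel"
    assume "det (A ** B) \<noteq> 0"
    then have nz: "det A \<noteq> 0" "det B \<noteq> 0"
      by (auto simp: det_mul)
    have "(\<integral>\<^sup>+x. g x \<partial>lborel) = ennreal \<bar>det A\<bar> * (\<integral>\<^sup>+x. g (A *v x) \<partial>lborel)"
      using that(1) nz g by (simp add: P_def)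
    also have "(\<integral>\<^sup>+x. g (A *v x) \<partial>lborel) = ennreal \<bar>det B\<bar> * (\<integral>\<^sup>+x. g (A *v (B *v x)) \<partial>lborel)"
    proof -
      have "(\<lambda>x. g (A *v x)) \<in> borel_measurable borel" by simp
      then show ?thesis
        using that(2) nz unfolding P_def by fastforce
    qed
    finally show "ennreal \<bar>det (A ** B)\<bar> * (\<integral>\<^sup>+x. g (A ** B *v x) \<partial>lborel) = (\<integral>\<^sup>+x. g x \<partial>lborel)"
      by (simp add: det_mul abs_mult ennreal_mult mult.assoc matrix_vector_mul_assoc)
  qed
  have involution: "P A" if A: "A ** A = mat 1" for A
  proof -
    have "det A * det A = 1"
      using arg_cong[OF A, of det] by (simp add: det_mul)
    then have "\<bar>det A\<bar> = 1"
      by (metis abs_1 abs_mult_self_eq abs_mult abs_ge_zero real_sqrt_abs2 real_sqrt_one)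
    then show ?thesis
      using nn_integral_involution[OF A] by (simp add: P_def)
  qed
  have "P A"
  proof (induction A rule: induct_matrix_elementary_alt)
    case (1 A B)
    then show ?case by (rule mult)
  next
    case (2 A i)
    then show ?case using det_zero_row by (auto simp: P_def)
  next
    case (3 A)
    then show ?case using nn_integral_diagonal by (auto simp: P_def)
  next
    case (4 m n)
    show ?case
    proof (rule involution)
      show "(\<chi> i j. mat 1 $ i $ Transposition.transpose m n j) **
        (\<chi> i j. mat 1 $ i $ Transposition.transpose m n j) = (mat 1 :: real^'n^'n)"
        (is "?S ** ?S = _")
      proof -
        have "(?S *v x) $ i = x $ Transposition.transpose m n i" for x :: "real^'n" and i
        proof -
          have "(?S *v x) $ i = (\<Sum>j\<in>UNIV. if j = Transposition.transpose m n i then x $ j else 0)"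
            unfolding matrix_vector_mult_def vec_lambda_beta
            by (rule sum.cong) (auto simp: mat_def)
          then show ?thesis by simp
        qed
        then show ?thesis
          by (simp add: matrix_eq vec_eq_iff flip: matrix_vector_mul_assoc)
      qed
    qed
  next
    case (5 m n)
    (* A shear becomes an involution when composed with the reflection F of the axis that it moves. *)
    define F :: "real^'n^'n" where "F = (\<chi> i j. if i = j then if i = m then -1 else 1 else 0)"
    define E :: "real^'n^'n" where "E = (\<chi> i j. of_bool (i = m \<and> j = n \<or> i = j))"
    have F: "(F *v x) $ i = (if i = m then - x$i else x$i)" for x i
    proof -
      have "(F *v x) $ i = (\<Sum>j\<in>UNIV. if j = i then (if i = m then - x$i else x$i) else 0)"
        unfolding matrix_vector_mult_def F_def vec_lambda_beta by (rule sum.cong) auto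
      then show ?thesis by simp
    qed
    have E: "(E *v x) $ i = (if i = m then x$m + x$n else x$i)" for x i
    proof -
      have "(E *v x) $ i = (\<Sum>j\<in>UNIV. (if j = i then x$i else 0) + (if j = n then of_bool (i = m) * x$n else 0))"
        unfolding matrix_vector_mult_def E_def vec_lambda_beta
        using \<open>m \<noteq> n\<close> by (intro sum.cong) auto
      then show ?thesis by (simp add: sum.distrib)
    qed
    have FF: "F ** F = mat 1"
      by (simp add: matrix_eq vec_eq_iff F flip: matrix_vector_mul_assoc)
    have FE: "(F ** E) ** (F ** E) = mat 1"
      using \<open>m \<noteq> n\<close> by (simp add: matrix_eq vec_eq_iff F E flip: matrix_vector_mul_assoc)
    have "E = F ** (F ** E)"
      by (simp add: matrix_mul_assoc FF)
    then show ?case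
      using mult[OF involution[OF FF] involution[OF FE]] by (simp add: E_def)
  qed
  with assms show ?thesis
    by (simp add: P_def)
qed

section \<open>Quadratic forms\<close>

lemma symmetric_matrix_inner:
  fixes D :: "real^'n^'n"
  assumes "symmetric_matrix D"
  shows "v \<bullet> (D *v w) = (D *v v) \<bullet> w"
  using assms by (metis symmetric_matrix_def dot_lmul_matrix transpose_matrix_vector)

text \<open>Gram--Schmidt for the inner product given by \<open>D\<close>: as long as there are
  fewer than \<open>n\<close> vectors \<open>v\<close>, some nonzero vector is orthogonal, in
  the standard sense, to all the \<open>D *v v\<close>.\<close>

lemma D_orthonormal_set_exists:
  fixes D :: "real^'n^'n"
  assumes D: "D \<in> pos_def_matrices" and "k \<le> CARD('n)"
  shows "\<exists>S. finite S \<and> card S = k \<and> (\<forall>v\<in>S. \<forall>w\<in>S. v \<bullet> (D *v w) = of_bool (v = w))"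
  using \<open>k \<le> CARD('n)\<close>
proof (induction k)
  case 0
  then show ?case by (intro exI[of _ "{}"]) auto
next
  case (Suc k)
  then obtain S where S: "finite S" "card S = k"
    and ortho: "\<And>v w. v \<in> S \<Longrightarrow> w \<in> S \<Longrightarrow> v \<bullet> (D *v w) = of_bool (v = w)"
    by auto
  have sym: "symmetric_matrix D"
    using D by (simp add: pos_def_matrices_def)
  have "dim ((*v) D ` S) \<le> card ((*v) D ` S)"
    by (rule dim_le_card') (use S in auto)
  also have "\<dots> \<le> k"
    using card_image_le[OF S(1)] S(2) by metis
  finally have "dim ((*v) D ` S) < DIM(real^'n)"
    using Suc.prems by simp
  then obtain w where w: "w \<noteq> 0" "\<And>y. y \<in> span ((*v) D ` S) \<Longrightarrow> orthogonal w y"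
    using orthogonal_to_subspace_exists by blast
  define c where "c = w \<bullet> (D *v w)"
  have c: "c > 0"
    using D w(1) by (simp add: c_def pos_def_matrices_def)
  define u where "u = (1 / sqrt c) *\<^sub>R w"
  have uu: "u \<bullet> (D *v u) = 1"
    using c by (simp add: u_def matrix_vector_mult_scaleR flip: c_def)
  have u0: "u \<bullet> (D *v v) = 0" if "v \<in> S" for v
    using w(2)[of "D *v v"] that by (simp add: u_def orthogonal_def span_base)
  have u0': "v \<bullet> (D *v u) = 0" if "v \<in> S" for v
    using u0[OF that] symmetric_matrix_inner[OF sym, of v u] by (simp add: inner_commute)
  have "u \<notin> S"
    using uu u0 by fastforce
  then show ?case
    using S ortho uu u0 u0' by (intro exI[of _ "insert u S"]) auto
qed

lemma pos_def_congruent_to_identity: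
  fixes D :: "real^'n^'n"
  assumes "D \<in> pos_def_matrices"
  obtains P :: "real^'n^'n" where "transpose P ** D ** P = mat 1"
proof -
  obtain S :: "(real^'n) set" where S: "finite S" "card S = CARD('n)"
    and ortho: "\<And>v w. v \<in> S \<Longrightarrow> w \<in> S \<Longrightarrow> v \<bullet> (D *v w) = of_bool (v = w)"
    using D_orthonormal_set_exists[OF assms order_refl] by auto
  obtain b where b: "bij_betw b (UNIV :: 'n set) S"
    using finite_same_card_bij[of "UNIV :: 'n set" S] S by auto
  define P :: "real^'n^'n" where "P = (\<chi> i j. b j $ i)"
  have "(transpose P ** D ** P) $ i $ j = b i \<bullet> (D *v b j)" for i j
    unfolding matrix_mul_assoc[symmetric]
    by (simp add: P_def matrix_matrix_mult_def transpose_def inner_vec_def matrix_vector_mult_def)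
  moreover have "b i \<in> S" "b i = b j \<longleftrightarrow> i = j" for i j
    using b by (auto simp: bij_betw_def inj_def)
  ultimately have "transpose P ** D ** P = mat 1"
    by (simp add: vec_eq_iff mat_def ortho)
  then show thesis by (rule that)
qed

lemma quadratic_form_congruence:
  fixes D P :: "real^'n^'n"
  shows "(P *v x) \<bullet> (D *v (P *v y)) = x \<bullet> ((transpose P ** D ** P) *v y)"
  by (metis dot_lmul_matrix matrix_vector_mul_assoc vector_transpose_matrix)

lemma pos_def_det_pos:
  fixes D :: "real^'n^'n"
  assumes "D \<in> pos_def_matrices"
  shows "det D > 0"
proof -
  obtain P :: "real^'n^'n" where "transpose P ** D ** P = mat 1"
    using pos_def_congruent_to_identity[OF assms] .
  then have "det (transpose P ** D ** P) = 1"
    by simp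
  then have "(det P)\<^sup>2 * det D = 1"
    by (simp add: det_mul det_transpose power2_eq_square mult_ac)
  then show ?thesis
    by (metis zero_less_mult_iff zero_less_one zero_le_power2 not_less)
qed

text \<open>Stated for measures and not for nonnegative functions, because the integrand of the
  Shannon entropy changes sign.\<close>

lemma distr_quadratic_form:
  fixes D :: "real^'n^'n"
  assumes "D \<in> pos_def_matrices"
  shows "distr lborel borel (\<lambda>x. x \<bullet> (D *v x)) =
    density (distr lborel borel (\<lambda>x::real^'n. x \<bullet> x)) (\<lambda>_. ennreal (1 / sqrt (det D)))"
proof (rule measure_eqI)
  fix T assume "T \<in> sets (distr lborel borel (\<lambda>x. x \<bullet> (D *v x)))"
  then have T [measurable]: "T \<in> sets borel" by simp
  obtain P :: "real^'n^'n" where P: "transpose P ** D ** P = mat 1"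
    using pos_def_congruent_to_identity[OF assms] .
  then have "det (transpose P ** D ** P) = 1"
    by simp
  then have "det D * (det P)\<^sup>2 = 1"
    by (simp add: det_mul det_transpose power2_eq_square mult_ac)
  then have "sqrt (det D) * \<bar>det P\<bar> = 1"
    by (metis real_sqrt_abs real_sqrt_mult real_sqrt_one)
  then have detP: "\<bar>det P\<bar> = 1 / sqrt (det D)"
    by (metis nonzero_mult_div_cancel_left mult_zero_left zero_neq_one)
  have nz: "det P \<noteq> 0"
    using \<open>det D * (det P)\<^sup>2 = 1\<close> by auto
  have [measurable]: "(\<lambda>x. x \<bullet> (D *v x)) \<in> borel_measurable borel" by simp
  have "emeasure (distr lborel borel (\<lambda>x. x \<bullet> (D *v x))) T =
    (\<integral>\<^sup>+x. indicator T (x \<bullet> (D *v x)) \<partial>lborel)"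
    by (simp add: nn_integral_distr flip: nn_integral_indicator)
  also have "\<dots> = ennreal (1 / sqrt (det D)) * (\<integral>\<^sup>+x. indicator T ((P *v x) \<bullet> (D *v (P *v x))) \<partial>lborel)"
    unfolding detP[symmetric]
    by (rule nn_integral_linear_change[OF nz, symmetric]) simp
  also have "\<dots> = ennreal (1 / sqrt (det D)) * (\<integral>\<^sup>+x. indicator T (x \<bullet> x) \<partial>(lborel :: (real^'n) measure))"
    by (simp add: quadratic_form_congruence P)
  also have "\<dots> = emeasure (density (distr lborel borel (\<lambda>x::real^'n. x \<bullet> x)) (\<lambda>_. ennreal (1 / sqrt (det D)))) T"
    by (subst emeasure_density) (simp_all add: nn_integral_cmult nn_integral_distr del: nn_integral_indicator)
  finally show "emeasure (distr lborel borel (\<lambda>x. x \<bullet> (D *v x))) T = \<dots>" .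
qed simp

lemma integral_quadratic_form:
  fixes D :: "real^'n^'n" and g :: "real \<Rightarrow> real"
  assumes D: "D \<in> pos_def_matrices" and [measurable]: "g \<in> borel_measurable borel"
  shows "integrable lborel (\<lambda>x. g (x \<bullet> (D *v x))) \<longleftrightarrow> integrable lborel (\<lambda>x::real^'n. g (x \<bullet> x))"
    and "(\<integral>x. g (x \<bullet> (D *v x)) \<partial>lborel) = (\<integral>x. g (x \<bullet> x) \<partial>(lborel :: (real^'n) measure)) / sqrt (det D)"
proof -
  have pos: "1 / sqrt (det D) > 0"
    using pos_def_det_pos[OF D] by simp
  have "integrable lborel (\<lambda>x. g (x \<bullet> (D *v x))) \<longleftrightarrow> integrable (distr lborel borel (\<lambda>x. x \<bullet> (D *v x))) g"
    by (simp add: integrable_distr_eq)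
  also have "\<dots> \<longleftrightarrow> integrable (distr lborel borel (\<lambda>x::real^'n. x \<bullet> x)) (\<lambda>x. (1 / sqrt (det D)) * g x)"
    unfolding distr_quadratic_form[OF D] using pos by (subst integrable_real_density) auto
  also have "\<dots> \<longleftrightarrow> integrable lborel (\<lambda>x::real^'n. g (x \<bullet> x))"
    using pos pos_def_det_pos[OF D] by (subst integrable_distr_eq) (auto simp: integrable_mult_right_iff simp del: times_divide_eq_left)
  finally show "integrable lborel (\<lambda>x. g (x \<bullet> (D *v x))) \<longleftrightarrow> integrable lborel (\<lambda>x::real^'n. g (x \<bullet> x))" .
  have "(\<integral>x. g (x \<bullet> (D *v x)) \<partial>lborel) = (\<integral>x. g x \<partial>distr lborel borel (\<lambda>x. x \<bullet> (D *v x)))"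
    by (simp add: integral_distr)
  also have "\<dots> = (\<integral>x. (1 / sqrt (det D)) * g x \<partial>distr lborel borel (\<lambda>x::real^'n. x \<bullet> x))"
    unfolding distr_quadratic_form[OF D] using pos by (subst integral_real_density) auto
  also have "\<dots> = (\<integral>x. g (x \<bullet> x) \<partial>(lborel :: (real^'n) measure)) / sqrt (det D)"
    by (subst integral_distr) auto
  finally show "(\<integral>x. g (x \<bullet> (D *v x)) \<partial>lborel) = \<dots>" .
qed

text \<open>On the unit sphere the form of \<open>D\<close> has a positive minimum, by
  compactness, and that of \<open>X\<close> is bounded.\<close>

lemma pos_def_perturb:
  fixes D X :: "real^'n^'n"
  assumes D: "D \<in> pos_def_matrices" and X: "symmetric_matrix X"
  shows "\<forall>\<^sub>F t in nhds 0. D + t *\<^sub>R X \<in> pos_def_matrices"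
proof -
  let ?S = "sphere (0 :: real^'n) 1"
  have ne: "?S \<noteq> {}" by simp
  have "compact ?S" by simp
  moreover have "continuous_on ?S (\<lambda>x. x \<bullet> (D *v x))"
    by (intro continuous_intros matrix_vector_mult_linear_continuous_on)
  ultimately obtain x0 where x0: "x0 \<in> ?S" "\<And>x. x \<in> ?S \<Longrightarrow> x0 \<bullet> (D *v x0) \<le> x \<bullet> (D *v x)"
    using continuous_attains_inf[of ?S] ne by blast
  define c where "c = x0 \<bullet> (D *v x0)"
  have c: "c > 0"
    using D x0(1) by (auto simp: c_def pos_def_matrices_def dest!: spec[of _ x0])
  obtain B where B: "B > 0" "\<And>x. norm (X *v x) \<le> norm x * B"
    using bounded_linear.pos_bounded[OF matrix_vector_mul_bounded_linear[of X]] by blast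
  have pd: "D + t *\<^sub>R X \<in> pos_def_matrices" if t: "\<bar>t\<bar> < c / B" for t
  proof -
    have "symmetric_matrix (D + t *\<^sub>R X)"
      using D X by (simp add: pos_def_matrices_def symmetric_matrix_def transpose_def vec_eq_iff)
    moreover have "0 < x \<bullet> ((D + t *\<^sub>R X) *v x)" if "x \<noteq> 0" for x
    proof -
      define y where "y = x /\<^sub>R norm x"
      have y: "norm y = 1" "x = norm x *\<^sub>R y" using that by (auto simp: y_def)
      have "\<bar>y \<bullet> (X *v y)\<bar> \<le> norm y * norm (X *v y)"
        by (rule Cauchy_Schwarz_ineq2)
      also have "\<dots> \<le> B"
        using B(2)[of y] y by simp
      finally have "\<bar>t * (y \<bullet> (X *v y))\<bar> \<le> \<bar>t\<bar> * B"
        by (simp add: abs_mult mult_left_mono)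
      also have "\<dots> < c"
        using t B(1) by (simp add: field_simps)
      also have "c \<le> y \<bullet> (D *v y)"
        using x0(2)[of y] y by (simp add: c_def)
      finally have "0 < y \<bullet> (D *v y) + t * (y \<bullet> (X *v y))"
        by linarith
      also have "\<dots> = y \<bullet> ((D + t *\<^sub>R X) *v y)"
        by (simp add: matrix_vector_mult_add_rdistrib inner_add_right scaleR_matrix_vector_assoc[symmetric])
      finally have "0 < y \<bullet> ((D + t *\<^sub>R X) *v y)" .
      then have "0 < norm x * (norm x * (y \<bullet> ((D + t *\<^sub>R X) *v y)))"
        using that by simp
      also have "\<dots> = x \<bullet> ((D + t *\<^sub>R X) *v x)"
        by (subst (3 4) y(2)) (simp add: matrix_vector_mult_scaleR)
      finally show ?thesis .
    qed
    ultimately show ?thesis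
      by (simp add: pos_def_matrices_def)
  qed
  have "\<forall>\<^sub>F t::real in nhds 0. \<bar>t\<bar> < c / B"
    using c B(1) by (intro eventually_nhds_metric[THEN iffD2] exI[of _ "c / B"]) (auto simp: dist_real_def)
  then show ?thesis
    by eventually_elim (rule pd)
qed

section \<open>Derivatives of the determinant\<close>

lemma matrix_inv_cancel:
  fixes M :: "real^'n^'n"
  assumes "det M \<noteq> 0"
  shows "M ** matrix_inv M = mat 1" "matrix_inv M ** M = mat 1"
proof -
  have "\<exists>M'. M ** M' = mat 1 \<and> M' ** M = mat 1"
    using assms by (metis invertible_det_nz invertible_def)
  then have "M ** matrix_inv M = mat 1 \<and> matrix_inv M ** M = mat 1"
    unfolding matrix_inv_def by (rule someI_ex)
  then show "M ** matrix_inv M = mat 1" "matrix_inv M ** M = mat 1"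
    by auto
qed

text \<open>Cramer's rule: row \<open>k\<close> of \<open>X\<close> is a combination of the rows
  of \<open>M\<close> in which row \<open>k\<close> itself has the coefficient \<open>(X **
  matrix_inv M) $ k $ k\<close>. The left-hand side is what the product rule yields for the
  determinant, and it is visibly continuous in \<open>M\<close>; both are exploited
  below.\<close>

lemma sum_det_replace_row:
  fixes M X :: "real^'n^'n"
  assumes "det M \<noteq> 0"
  shows "(\<Sum>k\<in>UNIV. det (\<chi> i. if i = k then X $ i else M $ i)) = det M * trace (X ** matrix_inv M)"
proof -
  define C where "C = X ** matrix_inv M"
  have X: "X = C ** M"
    using matrix_inv_cancel[OF assms] by (simp add: C_def flip: matrix_mul_assoc)
  have "det (\<chi> i. if i = k then X $ i else M $ i) = C$k$k * det M" for k
  proof -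
    have "(\<Sum>i\<in>UNIV. row k C $ i *s row i M) = X $ k"
      by (simp add: X vec_eq_iff matrix_matrix_mult_def row_def)
    then have "(\<chi> i. if i = k then X $ i else M $ i) =
      (\<chi> i. if i = k then (\<Sum>i\<in>UNIV. row k C $ i *s row i M) else row i M)"
      by (simp add: vec_eq_iff row_def)
    then show ?thesis
      using cramer_lemma_transpose[of k "row k C" M] by (simp add: row_def)
  qed
  then show ?thesis
    by (simp add: trace_def C_def sum_distrib_left mult.commute)
qed

text \<open>Jacobi's formula: the Leibniz expansion, differentiated by the product rule, is a
  sum of determinants in which one row of \<open>M\<close> is replaced by that of
  \<open>X\<close>.\<close>

lemma has_field_derivative_det:
  fixes M X :: "real^'n^'n"
  assumes "det M \<noteq> 0"
  shows "((\<lambda>t. det (M + t *\<^sub>R X)) has_field_derivative det M * trace (X ** matrix_inv M)) (at 0)"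
proof -
  let ?S = "{p. p permutes (UNIV :: 'n set)}"
  have row_prod: "(\<Prod>i\<in>UNIV. (if i = k then X $ i else M $ i) $ p i) = X$k$p k * (\<Prod>j\<in>UNIV-{k}. M$j$p j)"
    for k and p :: "'n \<Rightarrow> 'n"
    by (subst prod.remove[of _ k]) auto
  have "((\<lambda>t. det (M + t *\<^sub>R X)) has_field_derivative
    (\<Sum>p\<in>?S. of_int (sign p) * (\<Sum>i\<in>UNIV. X$i$p i * (\<Prod>j\<in>UNIV-{i}. M$j$p j)))) (at 0)"
    unfolding det_def
  proof (intro DERIV_sum DERIV_cmult)
    fix p :: "'n \<Rightarrow> 'n"
    have "((\<lambda>t. \<Prod>i\<in>UNIV. (M + t *\<^sub>R X) $ i $ p i) has_field_derivative
      (\<Sum>i\<in>UNIV. X$i$p i * (\<Prod>j\<in>UNIV-{i}. (M + 0 *\<^sub>R X)$j$p j))) (at 0)"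
      by (rule has_field_derivative_prod) (auto intro!: derivative_eq_intros)
    then show "((\<lambda>t. \<Prod>i\<in>UNIV. (M + t *\<^sub>R X) $ i $ p i) has_field_derivative
      (\<Sum>i\<in>UNIV. X$i$p i * (\<Prod>j\<in>UNIV-{i}. M$j$p j))) (at 0)"
      by simp
  qed
  also have "(\<Sum>p\<in>?S. of_int (sign p) * (\<Sum>i\<in>UNIV. X$i$p i * (\<Prod>j\<in>UNIV-{i}. M$j$p j))) =
    (\<Sum>p\<in>?S. \<Sum>k\<in>UNIV. of_int (sign p) * (\<Prod>i\<in>UNIV. (\<chi> i. if i = k then X $ i else M $ i) $ i $ p i))"
    by (simp add: sum_distrib_left row_prod)
  also have "\<dots> = (\<Sum>k\<in>UNIV. det (\<chi> i. if i = k then X $ i else M $ i))"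
    unfolding det_def by (rule sum.swap)
  also have "\<dots> = det M * trace (X ** matrix_inv M)"
    by (rule sum_det_replace_row[OF assms])
  finally show ?thesis .
qed

lemma tendsto_det:
  fixes A :: "'b \<Rightarrow> real^'n^'n"
  assumes "(A \<longlongrightarrow> L) F"
  shows "((\<lambda>s. det (A s)) \<longlongrightarrow> det L) F"
  unfolding det_def by (intro tendsto_intros assms)

text \<open>By Cramer's rule the trace is a quotient of determinants, hence of polynomials in
  the entries of the matrix.\<close>

lemma tendsto_trace_matrix_inv:
  fixes A :: "'b \<Rightarrow> real^'n^'n"
  assumes A: "(A \<longlongrightarrow> L) F" and L: "det L \<noteq> 0"
  shows "((\<lambda>s. trace (Z ** matrix_inv (A s))) \<longlongrightarrow> trace (Z ** matrix_inv L)) F"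
proof -
  define G where "G M = (\<Sum>k\<in>UNIV. det (\<chi> i. if i = k then Z $ i else M $ i)) / det M" for M :: "real^'n^'n"
  have G: "G M = trace (Z ** matrix_inv M)" if "det M \<noteq> 0" for M
    using that by (simp add: G_def sum_det_replace_row)
  have "((\<lambda>s. if i = k then Z $ i else A s $ i) \<longlongrightarrow> (if i = k then Z $ i else L $ i)) F" for i k
    by (cases "i = k") (auto intro!: tendsto_intros A)
  then have "((\<lambda>s. G (A s)) \<longlongrightarrow> G L) F"
    unfolding G_def using L by (intro tendsto_intros tendsto_det A)
  moreover have ev: "\<forall>\<^sub>F s in F. G (A s) = trace (Z ** matrix_inv (A s))"
    using tendsto_imp_eventually_ne[OF tendsto_det[OF A] L] by eventually_elim (rule G)
  ultimately show ?thesis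
    using G[OF L] tendsto_cong[OF ev, of "G L"] by simp
qed

text \<open>The resolvent identity \<open>M\<inverse> - D\<inverse> = - s D\<inverse> Y
  M\<inverse>\<close> for \<open>M = D + s Y\<close> expresses the difference quotient as a
  trace that is continuous in \<open>s\<close>.\<close>

lemma has_field_derivative_trace_matrix_inv:
  fixes D X Y :: "real^'n^'n"
  assumes D: "det D \<noteq> 0"
  shows "((\<lambda>s. trace (X ** matrix_inv (D + s *\<^sub>R Y))) has_field_derivative
    - trace (matrix_inv D ** X ** matrix_inv D ** Y)) (at 0)"
proof -
  define M where "M s = D + s *\<^sub>R Y" for s
  have M: "(M \<longlongrightarrow> D) (at 0)"
    unfolding M_def by (auto intro!: tendsto_eq_intros)
  have ev: "\<forall>\<^sub>F s in at 0. det (M s) \<noteq> 0"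
    using tendsto_imp_eventually_ne[OF tendsto_det[OF M] D] .
  have quot: "(trace (X ** matrix_inv (M s)) - trace (X ** matrix_inv D)) / s =
    - trace ((X ** matrix_inv D ** Y) ** matrix_inv (M s))" if "det (M s) \<noteq> 0" "s \<noteq> 0" for s
  proof -
    have distrib: "(A + B) ** C = A ** C + B ** C" for A B C :: "real^'n^'n"
      by (simp add: matrix_matrix_mult_def vec_eq_iff sum.distrib distrib_right)
    have "matrix_inv D = matrix_inv D ** M s ** matrix_inv (M s)"
      using matrix_inv_cancel[OF that(1)] by (simp flip: matrix_mul_assoc)
    have scale: "A ** (s *\<^sub>R B) = s *\<^sub>R (A ** B)" "(s *\<^sub>R A) ** B = s *\<^sub>R (A ** B)" for A B :: "real^'n^'n"
      by (simp_all add: matrix_matrix_mult_def vec_eq_iff sum_distrib_left mult_ac)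
    note \<open>matrix_inv D = matrix_inv D ** M s ** matrix_inv (M s)\<close>
    also have "matrix_inv D ** M s ** matrix_inv (M s) = matrix_inv (M s) + s *\<^sub>R (matrix_inv D ** Y ** matrix_inv (M s))"
      using matrix_inv_cancel[OF D]
      by (simp add: M_def matrix_add_ldistrib distrib scale)
    finally have "X ** matrix_inv D = X ** matrix_inv (M s) + s *\<^sub>R (X ** matrix_inv D ** Y ** matrix_inv (M s))"
      by (metis matrix_add_ldistrib scale(1) matrix_mul_assoc)
    moreover have "trace (s *\<^sub>R A) = s * trace A" for A :: "real^'n^'n"
      by (simp add: trace_def sum_distrib_left)
    ultimately have "trace (X ** matrix_inv D) =
      trace (X ** matrix_inv (M s)) + s * trace (X ** matrix_inv D ** Y ** matrix_inv (M s))"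
      by (metis trace_add)
    then show ?thesis
      using that(2) by (simp add: field_simps)
  qed
  have "((\<lambda>s. - trace ((X ** matrix_inv D ** Y) ** matrix_inv (M s))) \<longlongrightarrow>
    - trace ((X ** matrix_inv D ** Y) ** matrix_inv D)) (at 0)"
    by (intro tendsto_minus tendsto_trace_matrix_inv M D)
  moreover have "\<forall>\<^sub>F s in at 0. - trace ((X ** matrix_inv D ** Y) ** matrix_inv (M s)) =
     (trace (X ** matrix_inv (M s)) - trace (X ** matrix_inv D)) / s"
    using ev eventually_neq_at_within[of 0] by eventually_elim (simp add: quot)
  moreover have "trace ((X ** matrix_inv D ** Y) ** matrix_inv D) = trace (matrix_inv D ** X ** matrix_inv D ** Y)"
    by (metis trace_mul_sym matrix_mul_assoc)
  ultimately show ?thesis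
    unfolding has_field_derivative_iff by (simp add: M_def tendsto_cong)
qed

text \<open>The case \<open>a = 0\<close> is the logarithm, that is, the Shannon entropy; other
  values of \<open>a\<close> correspond to the Tsallis entropies. The formula for the derivative
  of \<open>h\<close> is chosen such that \<open>\<delta> * h' \<delta>\<close>, which is what
  Jacobi's formula produces, is again a power of \<open>\<delta>\<close>.\<close>

lemma mixed_partial_of_det:
  fixes D X Y :: "real^'n^'n"
  assumes D: "D \<in> pos_def_matrices" and X: "symmetric_matrix X" and Y: "symmetric_matrix Y"
    and h: "\<And>\<delta>. \<delta> > 0 \<Longrightarrow> (h has_field_derivative - K * \<delta> powr (a - 1)) (at \<delta>)"
    and F: "\<And>s t. D + t *\<^sub>R X + s *\<^sub>R Y \<in> pos_def_matrices \<Longrightarrow> F s t = h (det (D + t *\<^sub>R X + s *\<^sub>R Y))"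
  shows "mixed_partial_exists F"
    and "mixed_partial F = K * det D powr a *
      (trace (matrix_inv D ** X ** matrix_inv D ** Y)
        - a * trace (X ** matrix_inv D) * trace (Y ** matrix_inv D))"
proof -
  define M where "M s = D + s *\<^sub>R Y" for s
  define G where "G s = - K * det (M s) powr a * trace (X ** matrix_inv (M s))" for s
  have inner: "((\<lambda>t. F s t) has_field_derivative G s) (at 0)" if "M s \<in> pos_def_matrices" for s
  proof -
    have det: "det (M s) > 0"
      using pos_def_det_pos[OF that] .
    have "((\<lambda>t. h (det (M s + t *\<^sub>R X))) has_field_derivative
      (- K * det (M s) powr (a - 1)) * (det (M s) * trace (X ** matrix_inv (M s)))) (at 0)"
      by (rule DERIV_chain2[OF _ has_field_derivative_det]) (use det h in auto)
    also have "(- K * det (M s) powr (a - 1)) * (det (M s) * trace (X ** matrix_inv (M s))) = G s"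
      using det by (simp add: G_def powr_diff)
    finally have "((\<lambda>t. h (det (M s + t *\<^sub>R X))) has_field_derivative G s) (at 0)" .
    moreover have "\<forall>\<^sub>F t in nhds 0. F s t = h (det (M s + t *\<^sub>R X))"
      using pos_def_perturb[OF that X]
      by eventually_elim (simp add: F M_def algebra_simps)
    ultimately show ?thesis
      by (simp add: DERIV_cong_ev)
  qed
  have ev: "\<forall>\<^sub>F s in nhds 0. M s \<in> pos_def_matrices"
    unfolding M_def by (rule pos_def_perturb[OF D Y])
  have det: "det D > 0"
    using pos_def_det_pos[OF D] .
  let ?L = "K * det D powr a * (trace (matrix_inv D ** X ** matrix_inv D ** Y)
        - a * trace (X ** matrix_inv D) * trace (Y ** matrix_inv D))"
  have "((\<lambda>s. det (M s)) has_field_derivative det D * trace (Y ** matrix_inv D)) (at 0)"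
    unfolding M_def using det by (intro has_field_derivative_det) simp
  then have dpow: "((\<lambda>s. det (M s) powr a) has_field_derivative
      a * det D powr a * trace (Y ** matrix_inv D)) (at 0)"
    by (rule DERIV_fun_powr[THEN DERIV_cong]) (use det in \<open>auto simp: M_def powr_diff\<close>)
  have dtr: "((\<lambda>s. trace (X ** matrix_inv (M s))) has_field_derivative
    - trace (matrix_inv D ** X ** matrix_inv D ** Y)) (at 0)"
    unfolding M_def using det by (intro has_field_derivative_trace_matrix_inv) simp
  have "(G has_field_derivative ?L) (at 0)"
    unfolding G_def
    by (rule DERIV_cong[OF DERIV_mult[OF DERIV_cmult[OF dpow] dtr]]) (simp add: M_def algebra_simps)
  moreover have "\<forall>\<^sub>F s in nhds 0. deriv (\<lambda>t. F s t) 0 = G s"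
    using ev by eventually_elim (rule DERIV_imp_deriv[OF inner])
  ultimately have L: "((\<lambda>s. deriv (\<lambda>t. F s t) 0) has_field_derivative ?L) (at 0)"
    by (simp add: DERIV_cong_ev)
  then show "mixed_partial F = ?L"
    unfolding mixed_partial_def by (rule DERIV_imp_deriv)
  have "\<forall>\<^sub>F s in nhds 0. (\<lambda>t. F s t) field_differentiable at 0"
    using ev by eventually_elim (auto simp: field_differentiable_def intro: inner)
  with L show "mixed_partial_exists F"
    unfolding mixed_partial_exists_def field_differentiable_def by blast
qed

section \<open>Radial integrals\<close>

text \<open>Superpositions of indicator functions of balls are integrated by exchanging the
  order of integration.\<close>

lemma nn_integral_layer_cake_ball:
  fixes \<psi> h :: "real \<Rightarrow> real"
  assumes [measurable]: "\<psi> \<in> borel_measurable borel" "h \<in> borel_measurable borel"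
  shows "(\<integral>\<^sup>+(x::'a::euclidean_space). \<integral>\<^sup>+t. ennreal (\<psi> t) * indicator {t. x \<bullet> x \<le> h t} t \<partial>lborel \<partial>lborel) =
    ennreal (unit_ball_vol (DIM('a))) *
      (\<integral>\<^sup>+t. ennreal (\<psi> t) * ennreal (h t powr (DIM('a) / 2)) * indicator {t. 0 \<le> h t} t \<partial>lborel)"
proof -
  have slice: "(\<integral>\<^sup>+(x::'a). indicator {t. x \<bullet> x \<le> h t} t \<partial>lborel) =
      ennreal (unit_ball_vol (DIM('a))) * (ennreal (h t powr (DIM('a) / 2)) * indicator {t. 0 \<le> h t} t)" for t
  proof (cases "0 \<le> h t")
    case True
    have "(\<integral>\<^sup>+(x::'a). indicator {t. x \<bullet> x \<le> h t} t \<partial>lborel) = (\<integral>\<^sup>+x. indicator (cball (0::'a) (sqrt (h t))) x \<partial>lborel)"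
      using True by (intro nn_integral_cong) (auto simp: indicator_def norm_eq_sqrt_inner)
    also have "\<dots> = emeasure lborel (cball (0::'a) (sqrt (h t)))"
      by simp
    also have "\<dots> = ennreal (unit_ball_vol (DIM('a)) * sqrt (h t) ^ DIM('a))"
      using True by (intro emeasure_cball) simp
    also have "sqrt (h t) ^ DIM('a) = h t powr (DIM('a) / 2)"
    proof (cases "h t = 0")
      case False
      then have "sqrt (h t) ^ DIM('a) = (h t powr (1 / 2)) powr real DIM('a)"
        using True by (simp add: powr_half_sqrt powr_realpow)
      then show ?thesis by (simp add: powr_powr)
    qed simp
    finally show ?thesis
      using True by (simp add: ennreal_mult)
  next
    case False
    then have "indicator {t. x \<bullet> x \<le> h t} t = (0::ennreal)" for x :: 'a
      using inner_ge_zero[of x] by (auto simp: indicator_def simp del: inner_ge_zero)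
    then show ?thesis using False by simp
  qed
  have "(\<integral>\<^sup>+(x::'a). \<integral>\<^sup>+t. ennreal (\<psi> t) * indicator {t. x \<bullet> x \<le> h t} t \<partial>lborel \<partial>lborel) =
        (\<integral>\<^sup>+t. \<integral>\<^sup>+(x::'a). ennreal (\<psi> t) * indicator {t. x \<bullet> x \<le> h t} t \<partial>lborel \<partial>lborel)"
    by (rule lborel_pair.Fubini') (simp add: split_beta')
  also have "\<dots> = (\<integral>\<^sup>+t. ennreal (unit_ball_vol (DIM('a))) *
      (ennreal (\<psi> t) * ennreal (h t powr (DIM('a) / 2)) * indicator {t. 0 \<le> h t} t) \<partial>lborel)"
    by (intro nn_integral_cong) (simp add: nn_integral_cmult slice mult_ac)
  also have "\<dots> = ennreal (unit_ball_vol (DIM('a))) *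
      (\<integral>\<^sup>+t. ennreal (\<psi> t) * ennreal (h t powr (DIM('a) / 2)) * indicator {t. 0 \<le> h t} t \<partial>lborel)"
    by (rule nn_integral_cmult) simp
  finally show ?thesis .
qed

lemma nn_integral_Gamma_scaled:
  assumes s: "s > 0" and k: "(k::real) > 0"
  shows "(\<integral>\<^sup>+t. ennreal (t powr (s - 1) * exp (- (k * t))) * indicator {0..} t \<partial>lborel) =
    ennreal (Gamma s * k powr (- s))"
proof -
  have "ennreal (Gamma s) = (\<integral>\<^sup>+t. ennreal (indicator {0..} t * t powr (s - 1) / exp t) \<partial>lborel)"
    by (rule Gamma_conv_nn_integral_real[OF s])
  also have "\<dots> = ennreal k * (\<integral>\<^sup>+t. ennreal (indicator {0..} (k * t) * (k * t) powr (s - 1) / exp (k * t)) \<partial>lborel)"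
    using k by (subst nn_integral_real_affine[where c=k and t=0]) simp_all
  also have "\<dots> = (\<integral>\<^sup>+t. ennreal (k powr s) * (ennreal (t powr (s - 1) * exp (- (k * t))) * indicator {0..} t) \<partial>lborel)"
  proof -
    have "ennreal k * ennreal (indicator {0..} (k * t) * (k * t) powr (s - 1) / exp (k * t)) =
      ennreal (k powr s) * (ennreal (t powr (s - 1) * exp (- (k * t))) * indicator {0..} t)" for t
    proof (cases "t > 0")
      case True
      have "k * (k * t) powr (s - 1) = k powr s * t powr (s - 1)"
        using True k by (simp add: powr_mult powr_diff)
      then have "k * ((k * t) powr (s - 1) / exp (k * t)) = k powr s * (t powr (s - 1) * exp (- (k * t)))"
        by (simp add: exp_minus field_simps)
      then show ?thesis
        using True k by (simp flip: ennreal_mult)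
    next
      case False
      then have "indicator {0..} t * t powr (s - 1) = 0" "indicator {0..} (k * t) * (k * t) powr (s - 1) = 0"
        using k by (auto simp: indicator_def zero_le_mult_iff)
      then show ?thesis
        using False by (auto simp: indicator_def)
    qed
    then show ?thesis
      by (simp flip: nn_integral_cmult)
  qed
  also have "\<dots> = ennreal (k powr s) * (\<integral>\<^sup>+t. ennreal (t powr (s - 1) * exp (- (k * t))) * indicator {0..} t \<partial>lborel)"
    by (rule nn_integral_cmult) simp
  finally have "ennreal (k powr (- s)) * ennreal (Gamma s) = ennreal (k powr (- s)) * (ennreal (k powr s) *
    (\<integral>\<^sup>+t. ennreal (t powr (s - 1) * exp (- (k * t))) * indicator {0..} t \<partial>lborel))"
    by simp
  also have "\<dots> = (\<integral>\<^sup>+t. ennreal (t powr (s - 1) * exp (- (k * t))) * indicator {0..} t \<partial>lborel)"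
    using k by (simp add: mult.assoc[symmetric] ennreal_mult[symmetric] powr_minus)
  finally show ?thesis
    using s by (simp add: ennreal_mult[symmetric] Gamma_real_nonneg mult.commute)
qed

text \<open>The layers are obtained from \<open>exp (- (c * r)) = (\<integral>t\<in>{r..}. c *
  exp (- (c * t)))\<close>; the resulting Gamma value cancels the one in the volume of the unit
  ball.\<close>

lemma nn_integral_gaussian:
  assumes c: "(c::real) > 0"
  shows "(\<integral>\<^sup>+(x::'a::euclidean_space). ennreal (exp (- (c * (x \<bullet> x)))) \<partial>lborel) =
    ennreal ((pi / c) powr (DIM('a) / 2))"
proof -
  define n where "n = real DIM('a) / 2"
  have n: "n \<ge> 0" by (simp add: n_def)
  have tail: "ennreal (exp (- (c * r))) = (\<integral>\<^sup>+t. ennreal (c * exp (- (c * t))) * indicator {t. r \<le> t} t \<partial>lborel)" for r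
  proof -
    have "(\<integral>\<^sup>+t. ennreal (c * exp (- (c * t))) * indicator {r..} t \<partial>lborel) = ennreal (0 - (- exp (- (c * r))))"
    proof (rule nn_integral_FTC_atLeast)
      have "filterlim (\<lambda>t. c * t) at_top at_top"
        using c by (intro filterlim_tendsto_pos_mult_at_top[OF tendsto_const]) (auto intro: filterlim_ident)
      then have "filterlim (\<lambda>t. - (c * t)) at_bot at_top"
        by (simp add: filterlim_uminus_at_bot)
      then have "((\<lambda>t. exp (- (c * t))) \<longlongrightarrow> 0) at_top"
        by (rule filterlim_compose[OF exp_at_bot])
      then show "((\<lambda>t. - exp (- (c * t))) \<longlongrightarrow> 0) at_top"
        using tendsto_minus by fastforce
    qed (use c in \<open>auto intro!: derivative_eq_intros\<close>)
    then show ?thesis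
      by (simp add: atLeast_def)
  qed
  have "(\<integral>\<^sup>+(x::'a). ennreal (exp (- (c * (x \<bullet> x)))) \<partial>lborel) =
    ennreal (unit_ball_vol (DIM('a))) *
      (\<integral>\<^sup>+t. ennreal (c * exp (- (c * t))) * ennreal (t powr n) * indicator {t. 0 \<le> t} t \<partial>lborel)"
    unfolding tail n_def by (rule nn_integral_layer_cake_ball) simp_all
  also have "(\<integral>\<^sup>+t. ennreal (c * exp (- (c * t))) * ennreal (t powr n) * indicator {t. 0 \<le> t} t \<partial>lborel) =
    (\<integral>\<^sup>+t. ennreal c * (ennreal (t powr (n + 1 - 1) * exp (- (c * t))) * indicator {0..} t) \<partial>lborel)"
    using c by (intro nn_integral_cong) (auto simp: indicator_def mult_ac simp flip: ennreal_mult)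
  also have "\<dots> = ennreal c * ennreal (Gamma (n + 1) * c powr (- (n + 1)))"
    using c n by (subst nn_integral_cmult, simp, subst nn_integral_Gamma_scaled) auto
  also have "ennreal (unit_ball_vol (DIM('a))) * \<dots> =
    ennreal (unit_ball_vol (DIM('a)) * (c * (Gamma (n + 1) * c powr (- (n + 1)))))"
    using c by (simp flip: ennreal_mult')
  also have "unit_ball_vol (DIM('a)) * (c * (Gamma (n + 1) * c powr (- (n + 1)))) = (pi / c) powr n"
  proof -
    have "Gamma (n + 1) > 0" using n by (intro Gamma_real_pos) simp
    moreover have "c powr (- (n + 1)) = c powr (- n) / c"
      using c by (simp add: powr_diff)
    ultimately show ?thesis
      using c by (simp add: unit_ball_vol_def powr_divide powr_minus field_simps flip: n_def)
  qed
  finally show ?thesis unfolding n_def .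
qed

text \<open>A Gamma mixture of Gaussians. The integral on the right is left unevaluated since it
  is infinite if \<open>s \<le> DIM('a) / 2\<close>.\<close>

lemma nn_integral_one_plus_square_powr:
  assumes s: "s > 0"
  shows "ennreal (Gamma s) * (\<integral>\<^sup>+(x::'a::euclidean_space). ennreal ((1 + x \<bullet> x) powr (- s)) \<partial>lborel) =
    ennreal (pi powr (DIM('a) / 2)) *
    (\<integral>\<^sup>+t. ennreal (t powr (s - DIM('a) / 2 - 1) * exp (- t)) * indicator {0..} t \<partial>lborel)"
proof -
  define n where "n = real DIM('a) / 2"
  have "ennreal (Gamma s) * (\<integral>\<^sup>+(x::'a). ennreal ((1 + x \<bullet> x) powr (- s)) \<partial>lborel) =
    (\<integral>\<^sup>+(x::'a). ennreal (Gamma s * (1 + x \<bullet> x) powr (- s)) \<partial>lborel)"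
    using s by (subst nn_integral_cmult[symmetric]) (simp_all add: ennreal_mult Gamma_real_nonneg)
  also have "\<dots> = (\<integral>\<^sup>+(x::'a). \<integral>\<^sup>+t. ennreal (t powr (s - 1) * exp (- ((1 + x \<bullet> x) * t))) * indicator {0..} t \<partial>lborel \<partial>lborel)"
    by (intro nn_integral_cong nn_integral_Gamma_scaled[symmetric] s) (simp add: add_pos_nonneg)
  also have "\<dots> = (\<integral>\<^sup>+t. \<integral>\<^sup>+(x::'a). ennreal (t powr (s - 1) * exp (- ((1 + x \<bullet> x) * t))) * indicator {0..} t \<partial>lborel \<partial>lborel)"
    by (rule lborel_pair.Fubini') simp
  also have "\<dots> = (\<integral>\<^sup>+t. ennreal (pi powr n) * (ennreal (t powr (s - n - 1) * exp (- t)) * indicator {0..} t) \<partial>lborel)"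
  proof (rule nn_integral_cong_AE)
    have "(\<integral>\<^sup>+(x::'a). ennreal (t powr (s - 1) * exp (- ((1 + x \<bullet> x) * t))) * indicator {0..} t \<partial>lborel) =
      ennreal (pi powr n) * (ennreal (t powr (s - n - 1) * exp (- t)) * indicator {0..} t)" if "t \<noteq> 0" for t
    proof (cases "t > 0")
      case True
      have "(\<integral>\<^sup>+(x::'a). ennreal (t powr (s - 1) * exp (- ((1 + x \<bullet> x) * t))) * indicator {0..} t \<partial>lborel) =
        (\<integral>\<^sup>+(x::'a). ennreal (t powr (s - 1) * exp (- t)) * ennreal (exp (- (t * (x \<bullet> x)))) \<partial>lborel)"
        using True by (intro nn_integral_cong) (simp add: algebra_simps exp_add[symmetric] flip: ennreal_mult)
      also have "\<dots> = ennreal (t powr (s - 1) * exp (- t)) * ennreal ((pi / t) powr n)"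
        using True by (simp add: nn_integral_cmult nn_integral_gaussian n_def)
      also have "\<dots> = ennreal (pi powr n) * ennreal (t powr (s - n - 1) * exp (- t))"
        using True by (simp add: powr_divide powr_diff powr_minus mult_ac flip: ennreal_mult)
      finally show ?thesis using True by simp
    qed (use that in simp)
    then show "AE t in lborel. (\<integral>\<^sup>+(x::'a). ennreal (t powr (s - 1) * exp (- ((1 + x \<bullet> x) * t))) * indicator {0..} t \<partial>lborel) =
      ennreal (pi powr n) * (ennreal (t powr (s - n - 1) * exp (- t)) * indicator {0..} t)"
      using AE_lborel_singleton[of "0::real"] by auto
  qed
  also have "\<dots> = ennreal (pi powr n) *
    (\<integral>\<^sup>+t. ennreal (t powr (s - n - 1) * exp (- t)) * indicator {0..} t \<partial>lborel)"
    by (rule nn_integral_cmult) simp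
  finally show ?thesis unfolding n_def .
qed

text \<open>On \<open>{exp (- N)..1}\<close> the integrand is at least \<open>exp (-1) /
  t\<close>, whose integral there is \<open>exp (-1) * N\<close>.\<close>

lemma nn_integral_Gamma_diverges:
  assumes c: "c \<le> (0::real)"
  shows "(\<integral>\<^sup>+t. ennreal (t powr (c - 1) * exp (- t)) * indicator {0..} t \<partial>lborel) = \<infinity>"
proof (rule ccontr)
  let ?I = "\<integral>\<^sup>+t. ennreal (t powr (c - 1) * exp (- t)) * indicator {0..} t \<partial>lborel"
  have lower: "ennreal (exp (-1) * real N) \<le> ?I" for N
  proof -
    have "((\<lambda>t. exp (-1) * (1 / t)) has_integral (exp (-1) * ln 1 - exp (-1) * ln (exp (- real N)))) {exp (- real N)..1}"
      by (intro fundamental_theorem_of_calculus) 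
         (auto intro!: derivative_eq_intros simp flip: has_real_derivative_iff_has_vector_derivative 
            dest: less_le_trans[OF exp_gt_zero])
    then have "(\<integral>\<^sup>+t. ennreal (exp (-1) * (1 / t)) * indicator {exp (- real N)..1} t \<partial>lborel) =
       ennreal (exp (-1) * ln 1 - exp (-1) * ln (exp (- real N)))"
      by (intro nn_integral_has_integral_lebesgue') (auto dest: less_le_trans[OF exp_gt_zero])
    also have "\<dots> = ennreal (exp (-1) * real N)" by simp
    finally have "ennreal (exp (-1) * real N) = (\<integral>\<^sup>+t. ennreal (exp (-1) * (1 / t)) * indicator {exp (- real N)..1} t \<partial>lborel)" ..
    also have "\<dots> \<le> ?I"
    proof (rule nn_integral_mono)
      fix t :: real
      show "ennreal (exp (-1) * (1 / t)) * indicator {exp (- real N)..1} t \<le>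
        ennreal (t powr (c - 1) * exp (- t)) * indicator {0..} t"
      proof (cases "t \<in> {exp (- real N)..1}")
        case True
        then have t: "0 < t" "t \<le> 1"
          using less_le_trans[OF exp_gt_zero] by auto
        have "1 / t = t powr (- 1)"
          using t by (simp add: powr_minus divide_simps)
        also have "\<dots> \<le> t powr (c - 1)"
          using t c by (intro powr_mono') auto
        finally have "exp (-1) * (1 / t) \<le> exp (- t) * t powr (c - 1)"
          using t by (intro mult_mono) auto
        then show ?thesis
          using True t by (simp add: mult.commute)
      qed simp
    qed
    finally show ?thesis .
  qed
  assume "?I \<noteq> \<infinity>"
  then obtain r where r: "?I = ennreal r" "r \<ge> 0"
    by (cases ?I) auto
  obtain N :: nat where "r / exp (-1) < real N"
    using reals_Archimedean2 by blast
  then have "r < exp (-1) * real N"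
    by (simp add: divide_simps mult.commute)
  with lower[of N] r show False
    by (simp add: ennreal_le_iff)
qed

text \<open>The layers come from \<open>b powr s = (\<integral>t\<in>{0..b}. s * t powr (s -
  1))\<close> with \<open>b = 1 - x \<bullet> x\<close>.\<close>

lemma nn_integral_one_minus_square_powr:
  assumes s: "s > 0"
  shows "(\<integral>\<^sup>+(x::'a::euclidean_space). ennreal (max 0 (1 - x \<bullet> x) powr s) \<partial>lborel) =
    ennreal (pi powr (DIM('a) / 2) * Gamma (s + 1) / Gamma (s + 1 + DIM('a) / 2))"
proof -
  let ?n = "real DIM('a) / 2"
  have layer: "ennreal (max 0 (1 - r) powr s) =
    (\<integral>\<^sup>+t. ennreal (indicator {0..} t * (s * t powr (s - 1))) * indicator {t. r \<le> 1 - t} t \<partial>lborel)" if "r \<ge> 0" for r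
  proof (cases "r \<le> 1")
    case True
    have "((\<lambda>t. s * t powr (s - 1)) has_integral s * ((1 - r) powr (s - 1 + 1) / (s - 1 + 1))) {0..1 - r}"
      using s True by (intro has_integral_mult_right has_integral_powr_from_0) auto
    then have "(\<integral>\<^sup>+t. ennreal (s * t powr (s - 1)) * indicator {0..1 - r} t \<partial>lborel) = ennreal ((1 - r) powr s)"
      using s by (subst nn_integral_has_integral_lebesgue') auto
    moreover have "(\<integral>\<^sup>+t. ennreal (indicator {0..} t * (s * t powr (s - 1))) * indicator {t. r \<le> 1 - t} t \<partial>lborel) =
      (\<integral>\<^sup>+t. ennreal (s * t powr (s - 1)) * indicator {0..1 - r} t \<partial>lborel)"
      by (intro nn_integral_cong) (auto simp: indicator_def)
    ultimately show ?thesis using True by simp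
  next
    case False
    then have "(\<integral>\<^sup>+t. ennreal (indicator {0..} t * (s * t powr (s - 1))) * indicator {t. r \<le> 1 - t} t \<partial>lborel) =
      (\<integral>\<^sup>+(t::real). 0 \<partial>lborel)"
      by (intro nn_integral_cong) (auto simp: indicator_def)
    then show ?thesis using False s by simp
  qed
  have "(\<integral>\<^sup>+(x::'a). ennreal (max 0 (1 - x \<bullet> x) powr s) \<partial>lborel) =
    (\<integral>\<^sup>+(x::'a). \<integral>\<^sup>+t. ennreal (indicator {0..} t * (s * t powr (s - 1))) * indicator {t. x \<bullet> x \<le> 1 - t} t \<partial>lborel \<partial>lborel)"
    by (intro nn_integral_cong layer) simp
  also have "\<dots> = ennreal (unit_ball_vol (DIM('a))) *
      (\<integral>\<^sup>+t. ennreal (indicator {0..} t * (s * t powr (s - 1))) * ennreal ((1 - t) powr ?n) * indicator {t. 0 \<le> 1 - t} t \<partial>lborel)"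
    by (rule nn_integral_layer_cake_ball) simp_all
  also have "(\<integral>\<^sup>+t. ennreal (indicator {0..} t * (s * t powr (s - 1))) * ennreal ((1 - t) powr ?n) * indicator {t. 0 \<le> 1 - t} t \<partial>lborel) =
    (\<integral>\<^sup>+t. ennreal (s * (t powr (s - 1) * (1 - t) powr (?n + 1 - 1))) * indicator {0..1} t \<partial>lborel)"
    using s by (intro nn_integral_cong) (auto simp: indicator_def mult_ac simp flip: ennreal_mult)
  also have "\<dots> = ennreal (s * Beta s (?n + 1))"
    using s by (intro nn_integral_has_integral_lebesgue' has_integral_mult_right has_integral_Beta_real) auto
  also have "ennreal (unit_ball_vol (DIM('a))) * \<dots> = ennreal (unit_ball_vol (DIM('a)) * (s * Beta s (?n + 1)))"
    by (simp add: ennreal_mult')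
  also have "unit_ball_vol (DIM('a)) * (s * Beta s (?n + 1)) = pi powr ?n * Gamma (s + 1) / Gamma (s + 1 + ?n)"
  proof -
    have "Gamma (1 + ?n) \<noteq> 0"
      by (rule less_imp_neq[THEN not_sym], rule Gamma_real_pos) (simp add: add_pos_nonneg)
    moreover have "Gamma (s + 1) = s * Gamma s"
      using s by (intro Gamma_plus1) (auto elim!: nonpos_Ints_cases)
    ultimately show ?thesis
      by (simp add: unit_ball_vol_def Beta_def add_ac)
  qed
  finally show ?thesis .
qed

section \<open>Integrals of generalized Gaussian densities\<close>

text \<open>The densities for \<open>p < 1\<close>, \<open>p = 1\<close> and \<open>p > 1\<close> are brought to the form
  \<open>gauss_norm n p * sqrt (det D) * gauss_profile p (x \<bullet> ((gauss_scale n p *\<^sub>R D) *v x))\<close>: absorbing the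
  coefficient of the quadratic form into \<open>D\<close> leaves profiles free of \<open>n\<close>. For \<open>p > 1\<close> the
  truncation at 0 stands for the restriction to \<open>gen_gauss_dom p D 0\<close>.\<close>

definition gauss_scale :: "nat \<Rightarrow> real \<Rightarrow> real" where
  "gauss_scale n p = (if p = 1 then 1 / 2 else \<bar>1 - p\<bar> / (2 * p - real n * (1 - p)))"

definition gauss_profile :: "real \<Rightarrow> real \<Rightarrow> real" where
  "gauss_profile p r =
     (if p = 1 then exp (- r)
      else if p < 1 then (1 + r) powr (1 / (p - 1))
      else max 0 (1 - r) powr (1 / (p - 1)))"

definition gauss_norm :: "nat \<Rightarrow> real \<Rightarrow> real" where
  "gauss_norm n p = (if p = 1 then 1 / (2 * pi) powr (real n / 2) else gen_gauss_const n p)"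

text \<open>The integral over \<open>n\<close>-space of \<open>gauss_profile p (x \<bullet> x) powr q\<close>, when it is finite.\<close>

definition profile_mass :: "nat \<Rightarrow> real \<Rightarrow> real \<Rightarrow> real" where
  "profile_mass n p q =
     (if p = 1 then (pi / q) powr (real n / 2)
      else if p < 1 then pi powr (real n / 2) * Gamma (q / (1 - p) - real n / 2) / Gamma (q / (1 - p))
      else pi powr (real n / 2) * Gamma (q / (p - 1) + 1) / Gamma (q / (p - 1) + 1 + real n / 2))"

text \<open>The integral of \<open>gen_gauss p D 0 x powr q\<close> when \<open>det D = 1\<close>.\<close>

definition power_mass :: "nat \<Rightarrow> real \<Rightarrow> real \<Rightarrow> real" where
  "power_mass n p q = gauss_norm n p powr q * gauss_scale n p powr (- (real n / 2)) * profile_mass n p q"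

lemma gauss_profile_measurable [measurable]: "gauss_profile p \<in> borel_measurable borel"
  unfolding gauss_profile_def by measurable

lemma gauss_profile_nonneg: "gauss_profile p r \<ge> 0"
  by (simp add: gauss_profile_def)

lemma gauss_profile_le_1: "r \<ge> 0 \<Longrightarrow> gauss_profile p r \<le> 1"
  using powr_mono[of "1 / (p - 1)" 0 "1 + r"]
  by (auto simp: gauss_profile_def divide_le_0_iff intro!: powr_le1)

lemma gen_gauss_denominator_pos:
  assumes "p > real n / (real n + 2)"
  shows "2 * p - real n * (1 - p) > 0"
  using assms by (simp add: field_simps)

lemma gauss_scale_pos:
  assumes "p > real n / (real n + 2)"
  shows "gauss_scale n p > 0"
  using gen_gauss_denominator_pos[OF assms] by (simp add: gauss_scale_def)

lemma gen_gauss_exponent_gt: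
  assumes "p > real n / (real n + 2)" "p < 1"
  shows "1 / (1 - p) > real n / 2"
  using assms gen_gauss_denominator_pos[OF assms(1)]  by (simp add: field_simps)

lemma gauss_norm_pos:
  assumes "p > real n / (real n + 2)"
  shows "gauss_norm n p > 0"
proof -
  have d: "2 * p - real n * (1 - p) > 0"
    by (rule gen_gauss_denominator_pos[OF assms])
  consider "p = 1" | "p < 1" | "p > 1" by linarith
  then show ?thesis
  proof cases
    case 2
    then have "Gamma (1 / (1 - p)) > 0" "Gamma (1 / (1 - p) - real n / 2) > 0"
      using gen_gauss_exponent_gt[OF assms] by (auto intro!: Gamma_real_pos)
    then show ?thesis
      using 2 d by (simp add: gauss_norm_def gen_gauss_const_def)
  next
    case 3
    then have "Gamma (p / (p - 1)) > 0" "Gamma (p / (p - 1) + real n / 2) > 0"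
      by (auto intro!: Gamma_real_pos add_pos_nonneg)
    then show ?thesis
      using 3 d by (simp add: gauss_norm_def gen_gauss_const_def)
  qed (simp add: gauss_norm_def)
qed

lemma gen_gauss_profile:
  fixes D :: "real^'n^'n"
  assumes p: "p > real CARD('n) / (real CARD('n) + 2)"
  shows "gen_gauss p D 0 x =
    gauss_norm CARD('n) p * sqrt (det D) * gauss_profile p (x \<bullet> ((gauss_scale CARD('n) p *\<^sub>R D) *v x))"
proof -
  have d: "2 * p - real CARD('n) * (1 - p) > 0"
    by (rule gen_gauss_denominator_pos[OF p])
  define r where "r = x \<bullet> (D *v x)"
  have scaled: "x \<bullet> ((c *\<^sub>R D) *v x) = c * r" for c
    by (simp add: r_def scaleR_matrix_vector_assoc[symmetric])
  consider "p = 1" | "p < 1" | "p > 1" by linarith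
  then show ?thesis
  proof cases
    case 1
    then show ?thesis
      by (simp add: gen_gauss_def gauss_norm_def gauss_profile_def gauss_scale_def scaled flip: r_def)
  next
    case 2
    then show ?thesis
      by (simp add: gen_gauss_def gauss_norm_def gauss_profile_def gauss_scale_def scaled
          gen_gauss_dom_def gen_gauss_base_def flip: r_def)
  next
    case 3
    have "(1 - p) / (2 * p - real CARD('n) * (1 - p)) * r = - ((p - 1) / (2 * p - real CARD('n) * (1 - p)) * r)"
      by (metis minus_diff_eq minus_divide_left mult_minus_left)
    with 3 show ?thesis
      by (simp add: gen_gauss_def gauss_norm_def gauss_profile_def gauss_scale_def scaled
          gen_gauss_dom_def gen_gauss_base_def max_def flip: r_def)
  qed
qed

lemma gauss_profile_powr:
  "gauss_profile p r powr q =
    (if p = 1 then exp (- (q * r))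
     else if p < 1 then (1 + r) powr (- (q / (1 - p)))
     else max 0 (1 - r) powr (q / (p - 1)))"
proof -
  have "1 / (p - 1) * q = - (q / (1 - p))" if "p < 1"
    using that by (simp add: field_simps)
  moreover have "exp (- r) powr q = exp (- (q * r))"
    by (simp add: powr_def)
  ultimately show ?thesis
    by (simp add: gauss_profile_def powr_powr)
qed

lemma has_bochner_integral_profile_powr:
  assumes q: "q > 0" and pq: "p < 1 \<Longrightarrow> q > real DIM('a) * (1 - p) / 2"
  shows "has_bochner_integral lborel (\<lambda>x::'a::euclidean_space. gauss_profile p (x \<bullet> x) powr q)
    (profile_mass DIM('a) p q)"
proof (rule has_bochner_integral_nn_integral)
  have mass_nonneg: "profile_mass DIM('a) p q \<ge> 0"
  proof -
    consider "p = 1" | "p < 1" | "p > 1" by linarith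
    then show ?thesis
    proof cases
      case 2
      then have "Gamma (q / (1 - p)) > 0" "Gamma (q / (1 - p) - real DIM('a) / 2) > 0"
        using pq[OF 2] q by (auto intro!: Gamma_real_pos simp: field_simps)
      then show ?thesis using 2 by (simp add: profile_mass_def)
    next
      case 3
      then have "Gamma (q / (p - 1) + 1) > 0" "Gamma (q / (p - 1) + 1 + real DIM('a) / 2) > 0"
        using q by (auto intro!: Gamma_real_pos add_pos_nonneg)
      then show ?thesis using 3 by (simp add: profile_mass_def)
    qed (simp add: profile_mass_def)
  qed
  show "0 \<le> profile_mass DIM('a) p q" by (rule mass_nonneg)
  consider "p = 1" | "p < 1" | "p > 1" by linarith
  then show "(\<integral>\<^sup>+(x::'a). ennreal (gauss_profile p (x \<bullet> x) powr q) \<partial>lborel) = ennreal (profile_mass DIM('a) p q)"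
  proof cases
    case 1
    then show ?thesis
      using nn_integral_gaussian[OF q, where 'a='a] by (simp add: gauss_profile_powr profile_mass_def)
  next
    case 2
    define s where "s = q / (1 - p)"
    have s: "s > real DIM('a) / 2" "s > 0"
      using pq[OF 2] 2 q by (auto simp: s_def field_simps)
    have G: "Gamma s > 0" "Gamma (s - real DIM('a) / 2) > 0"
      using s by (auto intro!: Gamma_real_pos)
    have "ennreal (Gamma s) * (\<integral>\<^sup>+(x::'a). ennreal ((1 + x \<bullet> x) powr (- s)) \<partial>lborel) =
      ennreal (pi powr (DIM('a) / 2) * Gamma (s - real DIM('a) / 2))"
      using nn_integral_one_plus_square_powr[OF s(2), where 'a='a]
        nn_integral_Gamma_scaled[of "s - real DIM('a) / 2" 1] s G by (simp add: ennreal_mult)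
    then have "ennreal (1 / Gamma s) * (ennreal (Gamma s) * (\<integral>\<^sup>+(x::'a). ennreal ((1 + x \<bullet> x) powr (- s)) \<partial>lborel)) =
      ennreal (1 / Gamma s * (pi powr (DIM('a) / 2) * Gamma (s - real DIM('a) / 2)))"
      using G by (simp flip: ennreal_mult')
    then have "(\<integral>\<^sup>+(x::'a). ennreal ((1 + x \<bullet> x) powr (- s)) \<partial>lborel) =
      ennreal (1 / Gamma s * (pi powr (DIM('a) / 2) * Gamma (s - real DIM('a) / 2)))"
      using G by (simp add: mult.assoc[symmetric] ennreal_mult[symmetric])
    then show ?thesis
      using 2 by (simp add: gauss_profile_powr profile_mass_def flip: s_def)
  next
    case 3
    then show ?thesis
      using nn_integral_one_minus_square_powr[of "q / (p - 1)", where 'a='a] q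
      by (simp add: gauss_profile_powr profile_mass_def)
  qed
qed simp_all

lemma not_integrable_profile_powr:
  assumes q: "q > 0" and p: "p < 1" and pq: "q \<le> real DIM('a) * (1 - p) / 2"
  shows "\<not> integrable lborel (\<lambda>x::'a::euclidean_space. gauss_profile p (x \<bullet> x) powr q)"
proof
  assume int: "integrable lborel (\<lambda>x::'a. gauss_profile p (x \<bullet> x) powr q)"
  define s where "s = q / (1 - p)"
  have s: "s > 0" "s - real DIM('a) / 2 \<le> 0"
    using p q pq by (auto simp: s_def field_simps)
  have "(\<integral>\<^sup>+(x::'a). ennreal ((1 + x \<bullet> x) powr (- s)) \<partial>lborel) < \<infinity>"
    using integrableD(2)[OF int] p by (simp add: gauss_profile_powr less_top flip: s_def)
  then have "ennreal (Gamma s) * (\<integral>\<^sup>+(x::'a). ennreal ((1 + x \<bullet> x) powr (- s)) \<partial>lborel) < \<infinity>"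
    by (simp add: ennreal_mult_less_top)
  also have "ennreal (Gamma s) * (\<integral>\<^sup>+(x::'a). ennreal ((1 + x \<bullet> x) powr (- s)) \<partial>lborel) = \<infinity>"
    unfolding nn_integral_one_plus_square_powr[OF s(1)] nn_integral_Gamma_diverges[OF s(2)]
    by (simp add: ennreal_mult_top)
  finally show False by simp
qed

lemma integrable_profile_powr_iff:
  assumes "q > 0"
  shows "integrable lborel (\<lambda>x::'a::euclidean_space. gauss_profile p (x \<bullet> x) powr q) \<longleftrightarrow>
    (p < 1 \<longrightarrow> q > real DIM('a) * (1 - p) / 2)"
  using not_integrable_profile_powr[OF assms, of p, where 'a='a]
    has_bochner_integral_profile_powr[OF assms, of p, where 'a='a]
  by (meson integrable.intros not_le)

lemma scaleR_pos_def:
  fixes D :: "real^'n^'n"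
  assumes "D \<in> pos_def_matrices" "c > 0"
  shows "c *\<^sub>R D \<in> pos_def_matrices"
  using assms
  by (auto simp: pos_def_matrices_def symmetric_matrix_def transpose_def vec_eq_iff
      scaleR_matrix_vector_assoc[symmetric])

lemma det_scaleR:
  fixes D :: "real^'n^'n"
  shows "det (c *\<^sub>R D) = c ^ CARD('n) * det D"
proof -
  have "c *\<^sub>R D = (\<chi> i. c *s D $ i)"
    by (simp add: vec_eq_iff)
  then show ?thesis
    by (simp add: det_rows_mul)
qed

lemma sqrt_det_scaleR:
  fixes D :: "real^'n^'n"
  assumes "c > 0"
  shows "sqrt (det (c *\<^sub>R D)) = c powr (real CARD('n) / 2) * sqrt (det D)"
proof -
  have "sqrt (c ^ CARD('n)) = c powr (real CARD('n) / 2)"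
    using assms by (simp add: powr_half_sqrt[symmetric] powr_realpow[symmetric] powr_powr)
  then show ?thesis
    by (simp add: det_scaleR real_sqrt_mult)
qed

text \<open>The prefactor of the density contributes \<open>det D powr (q / 2)\<close> and the
  substitution \<open>det D powr (- 1 / 2)\<close>. Integrability is that of the radial profile
  and thus independent of \<open>D\<close>.\<close>

lemma gen_gauss_powr_integral:
  fixes D :: "real^'n^'n"
  assumes p: "p > real CARD('n) / (real CARD('n) + 2)" and D: "D \<in> pos_def_matrices" and q: "q > 0"
  shows "integrable lborel (\<lambda>x. gen_gauss p D 0 x powr q) \<longleftrightarrow> (p < 1 \<longrightarrow> q > real CARD('n) * (1 - p) / 2)"
    and "p < 1 \<longrightarrow> q > real CARD('n) * (1 - p) / 2 \<Longrightarrow>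
      (\<integral>x. gen_gauss p D 0 x powr q \<partial>lborel) = power_mass CARD('n) p q * det D powr ((q - 1) / 2)"
proof -
  define c where "c = gauss_scale CARD('n) p"
  define A where "A = gauss_norm CARD('n) p"
  have c: "c > 0" and A: "A > 0" and det: "det D > 0"
    using gauss_scale_pos[OF p] gauss_norm_pos[OF p] pos_def_det_pos[OF D] by (auto simp: c_def A_def)
  have cD: "c *\<^sub>R D \<in> pos_def_matrices"
    by (rule scaleR_pos_def[OF D c])
  define g where "g r = gauss_profile p r powr q" for r
  have [measurable]: "g \<in> borel_measurable borel"
    unfolding g_def by measurable
  define m where "m = A powr q * sqrt (det D) powr q"
  have m: "m > 0" using A det by (simp add: m_def)
  have f: "gen_gauss p D 0 x powr q = m * g (x \<bullet> ((c *\<^sub>R D) *v x))" for x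
    using A det by (simp add: gen_gauss_profile[OF p] m_def g_def powr_mult gauss_profile_nonneg flip: A_def c_def)
  have "integrable lborel (\<lambda>x. gen_gauss p D 0 x powr q) \<longleftrightarrow> integrable lborel (\<lambda>x::real^'n. g (x \<bullet> x))"
    unfolding f using m by (simp add: integral_quadratic_form(1)[OF cD])
  then show "integrable lborel (\<lambda>x. gen_gauss p D 0 x powr q) \<longleftrightarrow> (p < 1 \<longrightarrow> q > real CARD('n) * (1 - p) / 2)"
    unfolding g_def using integrable_profile_powr_iff[OF q, of p, where 'a="real^'n"] by simp
  assume pq: "p < 1 \<longrightarrow> q > real CARD('n) * (1 - p) / 2"
  have "(\<integral>x. gen_gauss p D 0 x powr q \<partial>lborel) = m * (profile_mass CARD('n) p q / sqrt (det (c *\<^sub>R D)))"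
    unfolding f integral_mult_right_zero integral_quadratic_form(2)[OF cD \<open>g \<in> borel_measurable borel\<close>]
    using has_bochner_integral_profile_powr[OF q, of p, where 'a="real^'n"] pq
    by (simp add: g_def has_bochner_integral_integral_eq)
  also have "\<dots> = power_mass CARD('n) p q * (sqrt (det D) powr q / sqrt (det D))"
    using c by (simp add: m_def power_mass_def sqrt_det_scaleR powr_minus field_simps flip: A_def c_def)
  also have "sqrt (det D) powr q / sqrt (det D) = det D powr ((q - 1) / 2)"
    using det by (simp add: powr_half_sqrt[symmetric] powr_powr powr_diff[symmetric] diff_divide_distrib)
  finally show "(\<integral>x. gen_gauss p D 0 x powr q \<partial>lborel) = power_mass CARD('n) p q * det D powr ((q - 1) / 2)" .
qed

text \<open>The quotient of the scale and \<open>pi\<close> enters with exponent \<open>n * q /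
  2\<close> through the normalizing constant and with exponent \<open>- n / 2\<close> through
  the substitution and the radial integral, which gives the single power in the constant of the
  metric.\<close>

lemma power_mass_eq:
  assumes p: "p > real n / (real n + 2)" "p \<noteq> 1"
  shows "power_mass n p q = 2 * tsallis_metric_const n p q"
proof -
  define d where "d = 2 * p - real n * (1 - p)"
  have d: "d > 0"
    unfolding d_def by (rule gen_gauss_denominator_pos[OF p(1)])
  have key: "((a / d) powr (real n / 2) * (G / pi powr (real n / 2))) powr q * (a / d) powr (- (real n / 2)) * pi powr (real n / 2) =
    (a / (pi * d)) powr (real n * (q - 1) / 2) * G powr q" if "a > 0" "G > 0" for a G :: real
  proof -
    have e: "real n * (q - 1) / 2 = real n / 2 * q - real n / 2"
      by (simp add: field_simps)
    have "((a / d) powr (real n / 2) * (G / pi powr (real n / 2))) powr q =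
      (a / d) powr (real n / 2 * q) * (G powr q / pi powr (real n / 2 * q))"
      using that d by (simp add: powr_mult powr_divide powr_powr)
    moreover have "(a / (pi * d)) powr (real n * (q - 1) / 2) = (a / d) powr (real n / 2 * q) / pi powr (real n / 2 * q)
       / ((a / d) powr (real n / 2) / pi powr (real n / 2))"
    proof -
      have "a / (pi * d) = (a / d) / pi" by simp
      moreover have "((a / d) / pi) powr x = (a / d) powr x / pi powr x" for x
        by (rule powr_divide)
      ultimately show ?thesis
        unfolding e by (simp only: powr_diff)
    qed
    moreover have "(a / d) powr (- (real n / 2)) = 1 / (a / d) powr (real n / 2)"
      by (rule powr_minus_divide)
    moreover have "x * (g / w) * (1 / y) * z = x / w / (y / z) * g" for x g w y z :: real
      by simp
    ultimately show ?thesis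
      by (simp only:)
  qed
  show ?thesis
  proof (cases "p < 1")
    case True
    then have "Gamma (1 / (1 - p)) > 0" "Gamma (1 / (1 - p) - real n / 2) > 0"
      using gen_gauss_exponent_gt[OF p(1)] by (auto intro!: Gamma_real_pos)
    then have "Gamma (1 / (1 - p)) / Gamma (1 / (1 - p) - real n / 2) > 0" by simp
    from key[OF _ this, of "1 - p"] True show ?thesis
      by (simp add: power_mass_def gauss_norm_def gen_gauss_const_def gauss_scale_def profile_mass_def
          tsallis_metric_const_def flip: d_def) (simp add: field_simps)
  next
    case False
    then have "Gamma (p / (p - 1)) > 0" "Gamma (p / (p - 1) + real n / 2) > 0"
      using p by (auto intro!: Gamma_real_pos add_pos_nonneg)
    then have "Gamma (p / (p - 1) + real n / 2) / Gamma (p / (p - 1)) > 0" by simp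
    from key[OF _ this, of "p - 1"] False p(2) show ?thesis
      by (simp add: power_mass_def gauss_norm_def gen_gauss_const_def gauss_scale_def profile_mass_def
          tsallis_metric_const_def flip: d_def) (simp add: field_simps)
  qed
qed

text \<open>The densities are normalized.\<close>

lemma power_mass_1:
  assumes p: "p > real n / (real n + 2)"
  shows "power_mass n p 1 = 1"
proof -
  consider "p = 1" | "p < 1" | "p > 1" by linarith
  then show ?thesis
  proof cases
    case 1
    then show ?thesis
      by (simp add: power_mass_def gauss_norm_def gauss_scale_def profile_mass_def powr_mult powr_minus powr_divide)
  next
    case 2
    then have "Gamma (1 / (1 - p)) > 0" "Gamma (1 / (1 - p) - real n / 2) > 0"
      using gen_gauss_exponent_gt[OF p] by (auto intro!: Gamma_real_pos)
    moreover from this have "Gamma (1 / (1 - p)) \<noteq> 0" "Gamma (1 / (1 - p) - real n / 2) \<noteq> 0"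
      by (metis less_irrefl)+
    ultimately show ?thesis
      using 2 gen_gauss_denominator_pos[OF p] by (subst power_mass_eq[OF p]) (auto simp: tsallis_metric_const_def)
  next
    case 3
    have e: "1 / (p - 1) + 1 = p / (p - 1)" using 3 by (simp add: field_simps)
    have "Gamma (p / (p - 1)) > 0" "Gamma (p / (p - 1) + real n / 2) > 0"
      using 3 by (auto intro!: Gamma_real_pos add_pos_nonneg)
    moreover from this have "Gamma (p / (p - 1)) \<noteq> 0" "Gamma (p / (p - 1) + real n / 2) \<noteq> 0"
      by (metis less_irrefl)+
    ultimately show ?thesis
      using 3 gen_gauss_denominator_pos[OF p] by (subst power_mass_eq[OF p]) (auto simp: tsallis_metric_const_def e)
  qed
qed

text \<open>By this bound, integrability of \<open>z * ln z\<close> reduces to integrability of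
  a power of \<open>z\<close> with an exponent slightly below 1.\<close>

lemma abs_mult_ln_le:
  fixes z \<delta> :: real
  assumes "0 \<le> z" "z \<le> 1" "0 < \<delta>" "\<delta> < 1"
  shows "\<bar>z * ln z\<bar> \<le> z powr (1 - \<delta>) / \<delta>"
proof (cases "z = 0")
  case False
  then have z: "z > 0" using assms by simp
  have "- (\<delta> * ln z) = ln (z powr (- \<delta>))"
    using z by (simp add: ln_powr)
  also have "\<dots> \<le> z powr (- \<delta>) - 1"
    using z by (intro ln_le_minus_one) simp
  finally have "- ln z \<le> z powr (- \<delta>) / \<delta>"
    using assms by (simp add: field_simps)
  then have "z * (- ln z) \<le> z * (z powr (- \<delta>) / \<delta>)"
    using z by (intro mult_left_mono) auto
  moreover have "ln z \<le> 0" using z assms by simp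
  then have "\<bar>z * ln z\<bar> = z * (- ln z)"
    using z by (simp add: abs_mult)
  moreover have "z * (z powr (- \<delta>) / \<delta>) = z powr (1 - \<delta>) / \<delta>"
    using z powr_mult_base[of z "- \<delta>"] by simp
  ultimately show ?thesis by linarith
qed simp

text \<open>For \<open>p < 1\<close>, the assumption on \<open>p\<close> gives \<open>DIM('a) *
  (1 - p) / 2 < 1\<close>, which leaves room for an exponent \<open>q < 1\<close> at which the
  \<open>q\<close>-th power is still integrable.\<close>

lemma integrable_profile_ln:
  assumes p: "p > real DIM('a) / (real DIM('a) + 2)"
  shows "integrable lborel (\<lambda>x::'a::euclidean_space. gauss_profile p (x \<bullet> x) * ln (gauss_profile p (x \<bullet> x)))"
proof -
  obtain q where q: "0 < q" "q < 1" "p < 1 \<longrightarrow> q > real DIM('a) * (1 - p) / 2"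
  proof (cases "p < 1")
    case True
    have "real DIM('a) * (1 - p) / 2 < 1"
      using gen_gauss_exponent_gt[OF p True] True by (simp add: field_simps)
    then obtain q where "real DIM('a) * (1 - p) / 2 < q" "q < 1"
      using dense by blast
    moreover have "0 \<le> real DIM('a) * (1 - p) / 2" using True by simp
    ultimately show thesis using that[of q] by linarith
  next
    case False
    then show thesis using that[of "1 / 2"] by simp
  qed
  define \<delta> where "\<delta> = 1 - q"
  have "integrable lborel (\<lambda>x::'a. gauss_profile p (x \<bullet> x) powr q / \<delta>)"
    using integrable_profile_powr_iff[OF q(1), of p, where 'a='a] q(3) by simp
  then show ?thesis
  proof (rule Bochner_Integration.integrable_bound)
    show "AE x::'a in lborel. norm (gauss_profile p (x \<bullet> x) * ln (gauss_profile p (x \<bullet> x)))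
      \<le> norm (gauss_profile p (x \<bullet> x) powr q / \<delta>)"
      using abs_mult_ln_le[OF gauss_profile_nonneg gauss_profile_le_1, of _ \<delta>] q
      by (intro always_eventually) (auto simp: \<delta>_def)
  qed simp
qed

text \<open>Where the density is positive, its logarithm is \<open>ln A + ln (det D) / 2\<close>
  plus the logarithm of the profile; the first two terms are multiplied by the total mass 1, and
  the last one integrates to a number independent of \<open>D\<close>.\<close>

lemma gen_gauss_entropy:
  fixes p :: real
  assumes p: "p > real CARD('n) / (real CARD('n) + 2)"
  shows "\<exists>K. \<forall>D \<in> pos_def_matrices :: (real^'n^'n) set.
    integrable lborel (\<lambda>x. gen_gauss p D 0 x * ln (gen_gauss p D 0 x)) \<and>
    (\<integral>x. gen_gauss p D 0 x * ln (gen_gauss p D 0 x) \<partial>lborel) = ln (det D) / 2 + K"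
proof -
  define c where "c = gauss_scale CARD('n) p"
  define A where "A = gauss_norm CARD('n) p"
  define g where "g r = gauss_profile p r * ln (gauss_profile p r)" for r
  define J where "J = (\<integral>x. g (x \<bullet> x) \<partial>(lborel :: (real^'n) measure))"
  define K where "K = ln A + A * J / c powr (real CARD('n) / 2)"
  have c: "c > 0" and A: "A > 0"
    using gauss_scale_pos[OF p] gauss_norm_pos[OF p] by (auto simp: c_def A_def)
  have gm [measurable]: "g \<in> borel_measurable borel"
    unfolding g_def by measurable
  have *: "integrable lborel (\<lambda>x. gen_gauss p D 0 x * ln (gen_gauss p D 0 x)) \<and>
      (\<integral>x. gen_gauss p D 0 x * ln (gen_gauss p D 0 x) \<partial>lborel) = ln (det D) / 2 + K"
    if D: "D \<in> pos_def_matrices" for D :: "real^'n^'n"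
  proof -
    let ?f = "\<lambda>x. gen_gauss p D 0 x"
    have det: "det D > 0" by (rule pos_def_det_pos[OF D])
    have cD: "c *\<^sub>R D \<in> pos_def_matrices" by (rule scaleR_pos_def[OF D c])
    have nonneg: "?f x \<ge> 0" for x
      using A det by (simp add: gen_gauss_profile[OF p] gauss_profile_nonneg flip: A_def)
    have p1: "p < 1 \<longrightarrow> 1 > real CARD('n) * (1 - p) / 2"
      using gen_gauss_exponent_gt[OF p] by (auto simp: field_simps)
    have f_int: "integrable lborel ?f"
      using gen_gauss_powr_integral(1)[OF p D, of 1] p1 nonneg by simp
    have f_1: "(\<integral>x. ?f x \<partial>lborel) = 1"
      using gen_gauss_powr_integral(2)[OF p D, of 1] p1 nonneg det by (simp add: power_mass_1[OF p])
    have split: "?f x * ln (?f x) = (ln A + ln (det D) / 2) * ?f x +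
      A * sqrt (det D) * g (x \<bullet> ((c *\<^sub>R D) *v x))" for x
    proof -
      define r where "r = gauss_profile p (x \<bullet> ((c *\<^sub>R D) *v x))"
      have f: "?f x = A * sqrt (det D) * r"
        by (simp add: gen_gauss_profile[OF p] r_def A_def c_def)
      show ?thesis
      proof (cases "r = 0")
        case False
        then have "r > 0" using gauss_profile_nonneg[of p] by (simp add: r_def less_le)
        then have "ln (?f x) = ln A + ln (det D) / 2 + ln r"
          using A det unfolding f by (simp add: ln_mult ln_sqrt)
        then show ?thesis
          by (simp add: f g_def algebra_simps flip: r_def)
      qed (simp add: f g_def flip: r_def)
    qed
    have g_int: "integrable lborel (\<lambda>x. g (x \<bullet> ((c *\<^sub>R D) *v x)))"
      using integrable_profile_ln[of p, where 'a="real^'n"] p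
      unfolding integral_quadratic_form(1)[OF cD gm] by (simp add: g_def)
    have "integrable lborel (\<lambda>x. ?f x * ln (?f x))"
      unfolding split using f_int g_int by simp
    moreover have "(\<integral>x. ?f x * ln (?f x) \<partial>lborel) = (ln A + ln (det D) / 2) +
      A * sqrt (det D) * (J / sqrt (det (c *\<^sub>R D)))"
      unfolding split using f_int g_int
      by (simp add: f_1 integral_quadratic_form(2)[OF cD gm] J_def)
    moreover have "A * sqrt (det D) * (J / sqrt (det (c *\<^sub>R D))) = A * J / c powr (real CARD('n) / 2)"
      using c det by (simp add: sqrt_det_scaleR)
    ultimately show ?thesis
      by (simp add: K_def)
  qed
  then show ?thesis by blast
qed

section \<open>The metric\<close>

theorem theorem3p3:
  fixes p :: real and D X Y :: "real^'n^'n"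
  assumes "p > real CARD('n) / (real CARD('n) + 2)"
    and "D \<in> pos_def_matrices"
    and "symmetric_matrix X" and "symmetric_matrix Y"
  shows "(tsallis_entropy_defined 1 (gen_gauss p D 0) \<and>
          tsallis_entropy_defined 1 (gen_gauss 1 D 0) \<and>
          tsallis_metric_exists p 1 D X Y \<and> tsallis_metric_exists 1 1 D X Y \<and>
          tsallis_metric p 1 D X Y = tsallis_metric 1 1 D X Y \<and>
          tsallis_metric 1 1 D X Y = 1 / 2 * trace (matrix_inv D ** X ** matrix_inv D ** Y))
       \<and> (\<forall>q. q > 0 \<and> q \<noteq> 1 \<and> p \<noteq> 1 \<longrightarrow>
            (tsallis_entropy_defined q (gen_gauss p D 0) \<longleftrightarrow>
               p > 1 \<or> (p < 1 \<and> q > real CARD('n) * (1 - p) / 2)))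
       \<and> (\<forall>q. q \<noteq> 1 \<and> (p > 1 \<and> q > 0 \<or> p < 1 \<and> q > real CARD('n) * (1 - p) / 2) \<longrightarrow>
            tsallis_metric_exists p q D X Y \<and>
            tsallis_metric p q D X Y =
              tsallis_metric_const CARD('n) p q * det D powr ((q - 1) / 2) *
              (trace (matrix_inv D ** X ** matrix_inv D ** Y)
               - (q - 1) / 2 * trace (X ** matrix_inv D) * trace (Y ** matrix_inv D)))"
proof -
  note D = assms(2) and X = assms(3) and Y = assms(4)
  have det: "det D > 0" by (rule pos_def_det_pos[OF D])
  have one: "tsallis_entropy_defined 1 (gen_gauss p' D 0)" "tsallis_metric_exists p' 1 D X Y"
      "tsallis_metric p' 1 D X Y = 1 / 2 * trace (matrix_inv D ** X ** matrix_inv D ** Y)"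
    if p': "p' > real CARD('n) / (real CARD('n) + 2)" for p'
  proof -
    obtain K where int: "\<And>D :: real^'n^'n. D \<in> pos_def_matrices \<Longrightarrow>
          integrable lborel (\<lambda>x. gen_gauss p' D 0 x * ln (gen_gauss p' D 0 x))"
      and K: "\<And>D :: real^'n^'n. D \<in> pos_def_matrices \<Longrightarrow>
          (\<integral>x. gen_gauss p' D 0 x * ln (gen_gauss p' D 0 x) \<partial>lborel) = ln (det D) / 2 + K"
      using gen_gauss_entropy[OF p'] by blast
    show "tsallis_entropy_defined 1 (gen_gauss p' D 0)"
      using int[OF D] by (simp add: tsallis_entropy_defined_def)
    have h: "((\<lambda>\<delta>. - (ln \<delta> / 2 + K)) has_field_derivative - (1 / 2) * \<delta> powr (0 - 1)) (at \<delta>)"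
      if "\<delta> > 0" for \<delta>
      using that by (auto intro!: derivative_eq_intros simp: powr_minus divide_simps)
    have F: "entropy_surface p' 1 D X Y s t = - (ln (det (D + t *\<^sub>R X + s *\<^sub>R Y)) / 2 + K)"
      if "D + t *\<^sub>R X + s *\<^sub>R Y \<in> pos_def_matrices" for s t
      by (simp add: entropy_surface_def tsallis_entropy_def K[OF that])
    show "tsallis_metric_exists p' 1 D X Y"
      unfolding tsallis_metric_exists_def by (rule mixed_partial_of_det(1)[OF D X Y h F])
    show "tsallis_metric p' 1 D X Y = 1 / 2 * trace (matrix_inv D ** X ** matrix_inv D ** Y)"
      unfolding tsallis_metric_def using mixed_partial_of_det(2)[OF D X Y h F] det by simp
  qed
  have defined: "tsallis_entropy_defined q (gen_gauss p D 0) \<longleftrightarrow>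
      p > 1 \<or> (p < 1 \<and> q > real CARD('n) * (1 - p) / 2)" if "q > 0" "q \<noteq> 1" "p \<noteq> 1" for q
    using gen_gauss_powr_integral(1)[OF assms(1) D \<open>q > 0\<close>] that
    by (auto simp: tsallis_entropy_defined_def)
  have metric: "tsallis_metric_exists p q D X Y \<and>
      tsallis_metric p q D X Y =
        tsallis_metric_const CARD('n) p q * det D powr ((q - 1) / 2) *
        (trace (matrix_inv D ** X ** matrix_inv D ** Y)
         - (q - 1) / 2 * trace (X ** matrix_inv D) * trace (Y ** matrix_inv D))"
    if q1: "q \<noteq> 1" and pq: "p > 1 \<and> q > 0 \<or> p < 1 \<and> q > real CARD('n) * (1 - p) / 2" for q
  proof -
    have "0 \<le> real CARD('n) * (1 - p) / 2" if "p < 1" using that by simp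
    then have q: "q > 0" using pq by linarith
    have p1: "p \<noteq> 1" and adm: "p < 1 \<longrightarrow> q > real CARD('n) * (1 - p) / 2" using pq by auto
    define A where "A = tsallis_metric_const CARD('n) p q"
    have mass: "power_mass CARD('n) p q = 2 * A"
      unfolding A_def by (rule power_mass_eq[OF assms(1) p1])
    (* The factor q - 1 from differentiating the power cancels the denominator of the entropy up to sign. *)
    have h: "((\<lambda>\<delta>. 1 / (1 - q) * (2 * A * \<delta> powr ((q - 1) / 2) - 1)) has_field_derivative
        - A * \<delta> powr ((q - 1) / 2 - 1)) (at \<delta>)" if "\<delta> > 0" for \<delta>
    proof -
      have "((\<lambda>\<delta>. 1 / (1 - q) * (2 * A * \<delta> powr ((q - 1) / 2) - 1)) has_field_derivative
          1 / (1 - q) * (2 * A * ((q - 1) / 2 * \<delta> powr ((q - 1) / 2 - 1)))) (at \<delta>)"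
        by (intro DERIV_cmult) (use that in \<open>auto intro!: derivative_eq_intros\<close>)
      also have "1 / (1 - q) * (2 * A * ((q - 1) / 2 * x)) = - A * x" for x
        using q1 by (simp add: divide_simps) (simp add: algebra_simps)
      finally show ?thesis .
    qed
    have F: "entropy_surface p q D X Y s t =
        1 / (1 - q) * (2 * A * det (D + t *\<^sub>R X + s *\<^sub>R Y) powr ((q - 1) / 2) - 1)"
      if "D + t *\<^sub>R X + s *\<^sub>R Y \<in> pos_def_matrices" for s t
      using q1 gen_gauss_powr_integral(2)[OF assms(1) that q adm]
      by (simp add: entropy_surface_def tsallis_entropy_def mass)
    show ?thesis
      unfolding tsallis_metric_exists_def tsallis_metric_def A_def[symmetric]
      using mixed_partial_of_det[OF D X Y h F] by blast
  qed
  have "(1::real) > real CARD('n) / (real CARD('n) + 2)" by simp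
  then show ?thesis
    using one[OF assms(1)] one[of 1] defined metric by auto
qed

end
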